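(* For each $n$ let $U_n$ be a unitary $n\times n$ matrix, with associated Frobenius-optimal (block-diagonal) preconditioning map $P_{U_n}:M_n(\mathbb{C})\to M_n(\mathbb{C})$. Let $\{g_1,\dots,g_m\}$ be a finite set of real-valued continuous $2\pi$-periodic functions such that $P_{U_n}(A_n(f))$ converges to $A_n(f)$ in strong cluster for every $f\in\{g_1,\dots,g_m,g_1^2,\dots,g_m^2\}$. Then $P_{U_n}(A_n(f))$ converges to $A_n(f)$ in strong cluster for every $f$ in the $C^*$-algebra generated by $\{g_1,\dots,g_m\}$.
   Context: Toeplitz matrices: for a continuous $2\pi$-periodic function $f$, $A_n(f)$ is the $n\times n$ matrix with entries $(A_n(f))_{j,k}=a_{j-k}$, where $a_k=\frac1{2\pi}\int_{0}^{2\pi}f(x)e^{-ikx}\,dx$. Preconditioning map: for each $n$ fix pairwise orthogonal orthogonal projections $P_{n_1},\dots,P_{n_{m_n}}$ in $M_n(\mathbb{C})$ with $\sum_{k=1}^{m_n}P_{n_k}=I_n$, and let $\Psi_n(X)=\sum_{k=1}^{m_n}P_{n_k}XP_{n_k}$ (pinching). Let $M_{U_n}=\{X\in M_n(\mathbb{C}): U_n^*XU_n \text{ is block diagonal, i.e. fixed by } \Psi_n\}$, and let $P_{U_n}(X)$ be the element of $M_{U_n}$ closest to $X$ in Frobenius norm; explicitly $P_{U_n}(X)=U_n\Psi_n(U_n^*XU_n)U_n^*$. (The case where the $P_{n_k}$ are the $n$ coordinate projections, so that $\Psi_n$ takes the diagonal part, is included.) Strong cluster: for sequences $\{X_n\},\{Y_n\}$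 of $n\times n$ matrices, $X_n$ converges to $Y_n$ in strong cluster if for every $\epsilon>0$ there exist integers $N_{1,\epsilon},N_{2,\epsilon}$ (independent of $n$) such that for all $n>N_{2,\epsilon}$ all singular values of $X_n-Y_n$ lie in $[0,\epsilon)$ except for at most $N_{1,\epsilon}$ of them (with multiplicity). The $C^*$-algebra is taken inside the algebra of continuous complex-valued $2\pi$-periodic functions with the sup norm. *)

theory Defs
  imports
    "HOL-Analysis.Henstock_Kurzweil_Integration"
    "HOL-Analysis.Uniform_Limit"
    "HOL-Computational_Algebra.Fundamental_Theorem_Algebra"
    "Jordan_Normal_Form.Schur_Decomposition"
begin

definition cont_periodic :: "(real \<Rightarrow> complex) set" where
  "cont_periodic = {f. continuous_on UNIV f \<and> (\<forall>x. f (x + 2 * pi) = f x)}"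

definition fourier_coeff :: "(real \<Rightarrow> complex) \<Rightarrow> int \<Rightarrow> complex" where
  "fourier_coeff f k =
     integral {0..2 * pi} (\<lambda>x. f x * exp (- \<i> * of_int k * of_real x)) / (2 * of_real pi)"

definition toeplitz :: "nat \<Rightarrow> (real \<Rightarrow> complex) \<Rightarrow> complex mat" where
  "toeplitz n f = mat n n (\<lambda>(j, k). fourier_coeff f (int j - int k))"

text \<open>Uniform convergence is convergence in the sup norm, so the last condition says that
  \<open>B\<close> is norm closed. Subalgebras are not required to contain the constant function 1.\<close>

definition cstar_subalgebra :: "(real \<Rightarrow> complex) set \<Rightarrow> bool" where
  "cstar_subalgebra B \<longleftrightarrow>
     B \<subseteq> cont_periodic \<and>
     (\<lambda>x. 0) \<in> B \<and>
     (\<forall>f\<in>B. \<forall>h\<in>B. (\<lambda>x. f x + h x) \<in> B) \<and>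
     (\<forall>c. \<forall>f\<in>B. (\<lambda>x. c * f x) \<in> B) \<and>
     (\<forall>f\<in>B. \<forall>h\<in>B. (\<lambda>x. f x * h x) \<in> B) \<and>
     (\<forall>f\<in>B. (\<lambda>x. cnj (f x)) \<in> B) \<and>
     (\<forall>F f. (\<forall>k. F k \<in> B) \<longrightarrow> uniform_limit UNIV F f sequentially \<longrightarrow> f \<in> B)"

definition generated_cstar :: "(real \<Rightarrow> complex) set \<Rightarrow> (real \<Rightarrow> complex) set" where
  "generated_cstar G = cstar_subalgebra hull G"

text \<open>The eigenvalues of \<open>A\<^sup>* A\<close>, with algebraic multiplicity, are non-negative reals.\<close>

definition singular_values :: "complex mat \<Rightarrow> real multiset" where
  "singular_values A = image_mset (\<lambda>z. sqrt (Re z)) (proots (char_poly (mat_adjoint A * A)))"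

definition strong_cluster :: "(nat \<Rightarrow> complex mat) \<Rightarrow> (nat \<Rightarrow> complex mat) \<Rightarrow> bool" where
  "strong_cluster X Y \<longleftrightarrow>
     (\<forall>\<epsilon>>0. \<exists>N1 N2. \<forall>n>N2. size {#s \<in># singular_values (X n - Y n). s \<notin> {0..<\<epsilon>}#} \<le> N1)"

definition unitary_mat :: "nat \<Rightarrow> complex mat \<Rightarrow> bool" where
  "unitary_mat n U \<longleftrightarrow>
     U \<in> carrier_mat n n \<and> mat_adjoint U * U = 1\<^sub>m n \<and> U * mat_adjoint U = 1\<^sub>m n"

definition msum :: "nat \<Rightarrow> nat \<Rightarrow> (nat \<Rightarrow> complex mat) \<Rightarrow> complex mat" where
  "msum n m F = mat n n (\<lambda>(i, j). \<Sum>k<m. F k $$ (i, j))"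

definition projection_resolution :: "nat \<Rightarrow> nat \<Rightarrow> (nat \<Rightarrow> complex mat) \<Rightarrow> bool" where
  "projection_resolution n m P \<longleftrightarrow>
     (\<forall>k<m. P k \<in> carrier_mat n n \<and> mat_adjoint (P k) = P k \<and> P k * P k = P k) \<and>
     (\<forall>k<m. \<forall>l<m. k \<noteq> l \<longrightarrow> P k * P l = 0\<^sub>m n n) \<and>
     msum n m P = 1\<^sub>m n"

definition pinching :: "nat \<Rightarrow> nat \<Rightarrow> (nat \<Rightarrow> complex mat) \<Rightarrow> complex mat \<Rightarrow> complex mat" where
  "pinching n m P X = msum n m (\<lambda>k. P k * X * P k)"

definition block_algebra ::
    "nat \<Rightarrow> nat \<Rightarrow> (nat \<Rightarrow> complex mat) \<Rightarrow> complex mat \<Rightarrow> complex mat set" where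
  "block_algebra n m P U =
     {X \<in> carrier_mat n n. pinching n m P (mat_adjoint U * X * U) = mat_adjoint U * X * U}"

definition frobenius_norm :: "complex mat \<Rightarrow> real" where
  "frobenius_norm A = sqrt (\<Sum>i<dim_row A. \<Sum>j<dim_col A. (cmod (A $$ (i, j)))\<^sup>2)"

text \<open>Existence and uniqueness of the minimiser are part of \<open>frobenius_precond_eq\<close> below.\<close>

definition frobenius_precond ::
    "nat \<Rightarrow> nat \<Rightarrow> (nat \<Rightarrow> complex mat) \<Rightarrow> complex mat \<Rightarrow> complex mat \<Rightarrow> complex mat" where
  "frobenius_precond n m P U X =
     (THE Y. Y \<in> block_algebra n m P U \<and>
        (\<forall>Z\<in>block_algebra n m P U. frobenius_norm (X - Y) \<le> frobenius_norm (X - Z)))"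

lemma cont_periodic_uniform_limit:
  assumes F: "\<forall>k::nat. F k \<in> cont_periodic" and u: "uniform_limit UNIV F f sequentially"
  shows "f \<in> cont_periodic"
proof -
  have c: "continuous_on UNIV f"
    by (rule uniform_limit_theorem[OF _ u]) (use F in \<open>simp_all add: cont_periodic_def\<close>)
  have l: "(\<lambda>k. F k x) \<longlonglongrightarrow> f x" for x
    using tendsto_uniform_limitI[OF u] by simp
  have "f (x + 2 * pi) = f x" for x
  proof (rule LIMSEQ_unique)
    show "(\<lambda>k. F k (x + 2 * pi)) \<longlonglongrightarrow> f (x + 2 * pi)" by (rule l)
    show "(\<lambda>k. F k (x + 2 * pi)) \<longlonglongrightarrow> f x"
      using l[of x] F by (simp add: cont_periodic_def)
  qed
  with c show ?thesis by (simp add: cont_periodic_def)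
qed

lemma cstar_subalgebra_cont_periodic: "cstar_subalgebra cont_periodic"
  unfolding cstar_subalgebra_def
proof (intro conjI allI impI)
  fix F :: "nat \<Rightarrow> real \<Rightarrow> complex" and f
  assume "\<forall>k. F k \<in> cont_periodic" "uniform_limit UNIV F f sequentially"
  then show "f \<in> cont_periodic" by (rule cont_periodic_uniform_limit)
qed (simp_all add: cont_periodic_def continuous_on_add continuous_on_mult continuous_on_cnj)

lemma generated_cstar_subalgebra:
  assumes "G \<subseteq> cont_periodic"
  shows "cstar_subalgebra (generated_cstar G)"
proof -
  have sub: "generated_cstar G \<subseteq> t" if "cstar_subalgebra t" "G \<subseteq> t" for t
    unfolding generated_cstar_def using that(2,1) by (rule hull_minimal)
  have mem: "f \<in> generated_cstar G \<longleftrightarrow> (\<forall>t. cstar_subalgebra t \<longrightarrow> G \<subseteq> t \<longrightarrow> f \<in> t)" for f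
    by (auto simp: generated_cstar_def hull_def)
  show ?thesis
    unfolding cstar_subalgebra_def
  proof (intro conjI ballI allI impI)
    show "generated_cstar G \<subseteq> cont_periodic"
      by (rule sub[OF cstar_subalgebra_cont_periodic assms])
  next
    fix F :: "nat \<Rightarrow> real \<Rightarrow> complex" and f
    assume F: "\<forall>k. F k \<in> generated_cstar G" and u: "uniform_limit UNIV F f sequentially"
    show "f \<in> generated_cstar G"
      unfolding mem
    proof (intro allI impI)
      fix t assume t: "cstar_subalgebra t" "G \<subseteq> t"
      then have "\<forall>k. F k \<in> t" using sub F by blast
      then show "f \<in> t" using t(1) u by (simp add: cstar_subalgebra_def)
    qed
  qed (simp_all add: mem cstar_subalgebra_def)
qed

lemma mat_adjoint_carrier [simp]:
  "A \<in> carrier_mat n k \<Longrightarrow> mat_adjoint A \<in> carrier_mat k n"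
  unfolding mat_adjoint_def by auto

lemma mat_adjoint_index:
  fixes A :: "complex mat"
  assumes "A \<in> carrier_mat n k" "i < k" "j < n"
  shows "mat_adjoint A $$ (i, j) = cnj (A $$ (j, i))"
  using assms unfolding mat_adjoint_def by (auto simp: mat_of_rows_def)

lemma mult_mat_index_sum:
  assumes "A \<in> carrier_mat n n" "B \<in> carrier_mat n n" "i < n" "j < n"
  shows "(A * B) $$ (i, j) = (\<Sum>k<n. A $$ (i, k) * B $$ (k, j))"
  using assms by (simp add: scalar_prod_def lessThan_atLeast0)

definition frobenius_inner :: "nat \<Rightarrow> complex mat \<Rightarrow> complex mat \<Rightarrow> complex" where
  "frobenius_inner n A B = (\<Sum>i<n. \<Sum>j<n. cnj (A $$ (i, j)) * B $$ (i, j))"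

lemma frobenius_inner_mult_left:
  assumes A: "A \<in> carrier_mat n n" and B: "B \<in> carrier_mat n n" and C: "C \<in> carrier_mat n n"
  shows "frobenius_inner n (C * A) B = frobenius_inner n A (mat_adjoint C * B)"
proof -
  have "frobenius_inner n (C * A) B =
      (\<Sum>i<n. \<Sum>j<n. \<Sum>k<n. cnj (C $$ (i, k)) * cnj (A $$ (k, j)) * B $$ (i, j))"
    unfolding frobenius_inner_def
    by (intro sum.cong refl) (simp add: mult_mat_index_sum[OF C A] sum_distrib_right del: index_mult_mat)
  also have "\<dots> = (\<Sum>i<n. \<Sum>k<n. \<Sum>j<n. cnj (C $$ (i, k)) * cnj (A $$ (k, j)) * B $$ (i, j))"
    by (intro sum.cong refl sum.swap)
  also have "\<dots> = (\<Sum>k<n. \<Sum>i<n. \<Sum>j<n. cnj (C $$ (i, k)) * cnj (A $$ (k, j)) * B $$ (i, j))"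
    by (rule sum.swap)
  also have "\<dots> = (\<Sum>k<n. \<Sum>j<n. \<Sum>i<n. cnj (C $$ (i, k)) * cnj (A $$ (k, j)) * B $$ (i, j))"
    by (intro sum.cong refl sum.swap)
  also have "\<dots> = frobenius_inner n A (mat_adjoint C * B)"
    unfolding frobenius_inner_def
    by (intro sum.cong refl)
      (simp add: mult_mat_index_sum[OF mat_adjoint_carrier[OF C] B] mat_adjoint_index[OF C]
        sum_distrib_left mult_ac del: index_mult_mat)
  finally show ?thesis .
qed

lemma frobenius_inner_mult_right:
  assumes A: "A \<in> carrier_mat n n" and B: "B \<in> carrier_mat n n" and C: "C \<in> carrier_mat n n"
  shows "frobenius_inner n (A * C) B = frobenius_inner n A (B * mat_adjoint C)"
proof -
  have "frobenius_inner n (A * C) B =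
      (\<Sum>i<n. \<Sum>j<n. \<Sum>k<n. cnj (A $$ (i, k)) * cnj (C $$ (k, j)) * B $$ (i, j))"
    unfolding frobenius_inner_def
    by (intro sum.cong refl) (simp add: mult_mat_index_sum[OF A C] sum_distrib_right del: index_mult_mat)
  also have "\<dots> = (\<Sum>i<n. \<Sum>k<n. \<Sum>j<n. cnj (A $$ (i, k)) * cnj (C $$ (k, j)) * B $$ (i, j))"
    by (intro sum.cong refl sum.swap)
  also have "\<dots> = frobenius_inner n A (B * mat_adjoint C)"
    unfolding frobenius_inner_def
    by (intro sum.cong refl)
      (simp add: mult_mat_index_sum[OF B mat_adjoint_carrier[OF C]] mat_adjoint_index[OF C]
        sum_distrib_left mult_ac del: index_mult_mat)
  finally show ?thesis .
qed

lemma msum_carrier [simp]: "msum n m F \<in> carrier_mat n n"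
  by (simp add: msum_def)

lemma frobenius_inner_msum_left:
  "frobenius_inner n (msum n m F) B = (\<Sum>k<m. frobenius_inner n (F k) B)"
proof -
  have "frobenius_inner n (msum n m F) B =
      (\<Sum>i<n. \<Sum>j<n. \<Sum>k<m. cnj (F k $$ (i, j)) * B $$ (i, j))"
    unfolding frobenius_inner_def
    by (intro sum.cong refl) (simp add: msum_def sum_distrib_right)
  also have "\<dots> = (\<Sum>i<n. \<Sum>k<m. \<Sum>j<n. cnj (F k $$ (i, j)) * B $$ (i, j))"
    by (intro sum.cong refl sum.swap)
  also have "\<dots> = (\<Sum>k<m. frobenius_inner n (F k) B)"
    unfolding frobenius_inner_def by (rule sum.swap)
  finally show ?thesis .
qed

lemma frobenius_inner_cnj: "frobenius_inner n A B = cnj (frobenius_inner n B A)"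
  by (simp add: frobenius_inner_def mult.commute)

lemma frobenius_inner_msum_right:
  "frobenius_inner n A (msum n m F) = (\<Sum>k<m. frobenius_inner n A (F k))"
  by (subst frobenius_inner_cnj, subst frobenius_inner_msum_left, subst cnj_sum)
    (simp flip: frobenius_inner_cnj)

lemma frobenius_inner_diff_left:
  assumes "A \<in> carrier_mat n n" "B \<in> carrier_mat n n"
  shows "frobenius_inner n (A - B) C = frobenius_inner n A C - frobenius_inner n B C"
  using assms by (simp add: frobenius_inner_def sum_subtractf ring_distribs)

lemma frobenius_inner_diff_right:
  assumes "A \<in> carrier_mat n n" "B \<in> carrier_mat n n"
  shows "frobenius_inner n C (A - B) = frobenius_inner n C A - frobenius_inner n C B"
  using assms by (simp add: frobenius_inner_def sum_subtractf ring_distribs)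

lemma frobenius_inner_self:
  assumes "A \<in> carrier_mat n n"
  shows "frobenius_inner n A A = of_real ((frobenius_norm A)\<^sup>2)"
proof -
  have "frobenius_inner n A A = of_real (\<Sum>i<n. \<Sum>j<n. (cmod (A $$ (i, j)))\<^sup>2)"
    by (simp add: frobenius_inner_def complex_norm_square mult.commute del: of_real_power)
  moreover have "(frobenius_norm A)\<^sup>2 = (\<Sum>i<n. \<Sum>j<n. (cmod (A $$ (i, j)))\<^sup>2)"
    using assms by (simp add: frobenius_norm_def sum_nonneg)
  ultimately show ?thesis by simp
qed

lemma frobenius_norm_nonneg [simp]: "0 \<le> frobenius_norm A"
  by (simp add: frobenius_norm_def sum_nonneg)

lemma frobenius_norm_diff_eq_0:
  assumes A: "A \<in> carrier_mat n n" and B: "B \<in> carrier_mat n n" and "frobenius_norm (A - B) = 0"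
  shows "A = B"
proof -
  have "(\<Sum>i<n. \<Sum>j<n. (cmod ((A - B) $$ (i, j)))\<^sup>2) = 0"
    using assms unfolding frobenius_norm_def by (simp del: index_minus_mat(1))
  then have "\<forall>i<n. \<forall>j<n. (A - B) $$ (i, j) = 0"
    by (simp add: sum_nonneg_eq_0_iff sum_nonneg del: index_minus_mat(1))
  with A B show ?thesis by (intro eq_matI) auto
qed

lemma pinching_carrier [simp]: "pinching n m P X \<in> carrier_mat n n"
  by (simp add: pinching_def)

lemma mult_msum_left:
  assumes A: "A \<in> carrier_mat n n" and F: "\<And>k. k < m \<Longrightarrow> F k \<in> carrier_mat n n"
  shows "A * msum n m F = msum n m (\<lambda>k. A * F k)"
proof (rule eq_matI)
  fix i j assume "i < dim_row (msum n m (\<lambda>k. A * F k))" "j < dim_col (msum n m (\<lambda>k. A * F k))"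
  then have ij: "i < n" "j < n" by (auto simp: msum_def)
  have "(A * msum n m F) $$ (i, j) = (\<Sum>l<n. \<Sum>k<m. A $$ (i, l) * F k $$ (l, j))"
    unfolding mult_mat_index_sum[OF A msum_carrier ij]
    using ij by (simp add: msum_def sum_distrib_left)
  also have "\<dots> = (\<Sum>k<m. \<Sum>l<n. A $$ (i, l) * F k $$ (l, j))" by (rule sum.swap)
  also have "\<dots> = (\<Sum>k<m. (A * F k) $$ (i, j))"
    by (intro sum.cong refl) (use mult_mat_index_sum[OF A F ij] in simp)
  finally show "(A * msum n m F) $$ (i, j) = msum n m (\<lambda>k. A * F k) $$ (i, j)"
    using ij by (simp add: msum_def)
qed (use A in \<open>auto simp: msum_def\<close>)

lemma mult_msum_right:
  assumes A: "A \<in> carrier_mat n n" and F: "\<And>k. k < m \<Longrightarrow> F k \<in> carrier_mat n n"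
  shows "msum n m F * A = msum n m (\<lambda>k. F k * A)"
proof (rule eq_matI)
  fix i j assume "i < dim_row (msum n m (\<lambda>k. F k * A))" "j < dim_col (msum n m (\<lambda>k. F k * A))"
  then have ij: "i < n" "j < n" by (auto simp: msum_def)
  have "(msum n m F * A) $$ (i, j) = (\<Sum>l<n. \<Sum>k<m. F k $$ (i, l) * A $$ (l, j))"
    unfolding mult_mat_index_sum[OF msum_carrier A ij]
    using ij by (simp add: msum_def sum_distrib_right)
  also have "\<dots> = (\<Sum>k<m. \<Sum>l<n. F k $$ (i, l) * A $$ (l, j))" by (rule sum.swap)
  also have "\<dots> = (\<Sum>k<m. (F k * A) $$ (i, j))"
    by (intro sum.cong refl) (use mult_mat_index_sum[OF F A ij] in simp)
  finally show "(msum n m F * A) $$ (i, j) = msum n m (\<lambda>k. F k * A) $$ (i, j)"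
    using ij by (simp add: msum_def)
qed (use A in \<open>auto simp: msum_def\<close>)

lemma pinching_idem:
  assumes P: "projection_resolution n m P" and X: "X \<in> carrier_mat n n"
  shows "pinching n m P (pinching n m P X) = pinching n m P X"
proof -
  have Pc: "P k \<in> carrier_mat n n" and P2: "P k * P k = P k" if "k < m" for k
    using P that by (auto simp: projection_resolution_def)
  have P0: "P k * P l = 0\<^sub>m n n" if "k < m" "l < m" "k \<noteq> l" for k l
    using P that by (auto simp: projection_resolution_def)
  have "P l * pinching n m P X * P l = P l * X * P l" if l: "l < m" for l
  proof -
    have t: "P l * (P k * X * P k) * P l = (if k = l then P l * X * P l else 0\<^sub>m n n)"
      if k: "k < m" for k
    proof -
      have "P l * (P k * X * P k) * P l = (P l * P k) * X * (P k * P l)"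
        using Pc[OF l] Pc[OF k] X by (simp add: assoc_mult_mat[where ?n\<^sub>1 = n and ?n\<^sub>2 = n and ?n\<^sub>3 = n and ?n\<^sub>4 = n])
      also have "\<dots> = (if k = l then P l * X * P l else 0\<^sub>m n n)"
        using P0[OF l k] P0[OF k l] P2[OF l] X Pc[OF l] by (auto simp: P2)
      finally show ?thesis .
    qed
    have "P l * pinching n m P X * P l = msum n m (\<lambda>k. P l * (P k * X * P k) * P l)"
    proof -
      have c: "P k * X * P k \<in> carrier_mat n n" if "k < m" for k
        using Pc[OF that] X by simp
      moreover have "P l * (P k * X * P k) \<in> carrier_mat n n" if k: "k < m" for k
        by (rule mult_carrier_mat[OF Pc[OF l] c[OF k]])
      ultimately show ?thesis
        unfolding pinching_def
        by (simp add: mult_msum_left[OF Pc[OF l]] mult_msum_right[OF Pc[OF l]])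
    qed
    also have "\<dots> = msum n m (\<lambda>k. if k = l then P l * X * P l else 0\<^sub>m n n)"
      unfolding msum_def by (rule cong_mat) (auto simp: t intro!: sum.cong)
    also have "\<dots> = P l * X * P l"
      by (rule eq_matI) (use Pc[OF l] X l in \<open>auto simp: msum_def if_distrib if_distribR cong: if_cong\<close>)
    finally show ?thesis .
  qed
  then have "msum n m (\<lambda>k. P k * pinching n m P X * P k) = msum n m (\<lambda>k. P k * X * P k)"
    unfolding msum_def by (intro cong_mat) simp_all
  then show ?thesis by (simp only: pinching_def)
qed

lemma frobenius_inner_pinching:
  assumes P: "projection_resolution n m P"
    and A: "A \<in> carrier_mat n n" and B: "B \<in> carrier_mat n n"
  shows "frobenius_inner n (pinching n m P A) B = frobenius_inner n A (pinching n m P B)"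
  unfolding pinching_def frobenius_inner_msum_left frobenius_inner_msum_right
proof (rule sum.cong)
  fix k assume "k \<in> {..<m}"
  then have Pk: "P k \<in> carrier_mat n n" "mat_adjoint (P k) = P k"
    using P by (auto simp: projection_resolution_def)
  have "frobenius_inner n (P k * A * P k) B = frobenius_inner n (P k * A) (B * P k)"
    using frobenius_inner_mult_right[of "P k * A" n B "P k"] Pk A B by simp
  also have "\<dots> = frobenius_inner n A (P k * (B * P k))"
    using frobenius_inner_mult_left[of A n "B * P k" "P k"] Pk A B by simp
  finally show "frobenius_inner n (P k * A * P k) B = frobenius_inner n A (P k * B * P k)"
    using assoc_mult_mat[OF Pk(1) B Pk(1)] by simp
qed simp

lemma frobenius_precond_eq:
  assumes P: "projection_resolution n m P" and U: "unitary_mat n U" and X: "X \<in> carrier_mat n n"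
  defines "Y \<equiv> U * pinching n m P (mat_adjoint U * X * U) * mat_adjoint U"
  shows "frobenius_precond n m P U X = Y"
    and "Y \<in> block_algebra n m P U"
    and "Z \<in> block_algebra n m P U \<Longrightarrow> frobenius_norm (X - Y) \<le> frobenius_norm (X - Z)"
    and "Z \<in> block_algebra n m P U \<Longrightarrow> frobenius_norm (X - Z) \<le> frobenius_norm (X - Y) \<Longrightarrow> Z = Y"
proof -
  let ?V = "mat_adjoint U"
  have Uc: "U \<in> carrier_mat n n" and VU: "?V * U = 1\<^sub>m n" and UV: "U * ?V = 1\<^sub>m n"
    using U by (auto simp: unitary_mat_def)
  have Vc: "?V \<in> carrier_mat n n" using Uc by simp
  have VV: "mat_adjoint ?V = U"
    by (rule eq_matI) (use Uc mat_adjoint_index[OF Vc] mat_adjoint_index[OF Uc] carrier_matD[OF mat_adjoint_carrier[OF Vc]] in auto)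
  note assoc = assoc_mult_mat[where ?n\<^sub>1 = n and ?n\<^sub>2 = n and ?n\<^sub>3 = n and ?n\<^sub>4 = n]
  note [simp] = mult_carrier_mat[where nr = n and n = n and nc = n]
  have cancel1: "?V * (U * S * ?V) * U = S" if S: "S \<in> carrier_mat n n" for S
  proof -
    have "?V * (U * S * ?V) * U = (?V * U) * S * (?V * U)"
      using Uc Vc S by (simp add: assoc)
    then show ?thesis using S by (simp add: VU)
  qed
  have cancel2: "U * (?V * S * U) * ?V = S" if S: "S \<in> carrier_mat n n" for S
  proof -
    have "U * (?V * S * U) * ?V = (U * ?V) * S * (U * ?V)"
      using Uc Vc S by (simp add: assoc)
    then show ?thesis using S by (simp add: UV)
  qed
  define T where "T = ?V * X * U"
  have Tc: "T \<in> carrier_mat n n" using Uc Vc X by (simp add: T_def)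
  have Yc: "Y \<in> carrier_mat n n" using Uc Vc by (simp add: Y_def)
  have VYU: "?V * Y * U = pinching n m P T"
    unfolding Y_def T_def by (rule cancel1) simp
  show YM: "Y \<in> block_algebra n m P U"
    using Yc by (simp add: block_algebra_def VYU pinching_idem[OF P Tc])
  have orth: "frobenius_inner n (X - Y) Z = 0" if Z: "Z \<in> block_algebra n m P U" for Z
  proof -
    define S where "S = ?V * Z * U"
    have Zc: "Z \<in> carrier_mat n n" and PS: "pinching n m P S = S"
      using Z by (auto simp: block_algebra_def S_def)
    have Sc: "S \<in> carrier_mat n n" using Uc Vc Zc by (simp add: S_def)
    have tr: "frobenius_inner n W Z = frobenius_inner n (?V * W * U) S"
      if W: "W \<in> carrier_mat n n" for W
    proof -
      have "frobenius_inner n (?V * W * U) S = frobenius_inner n W (U * (S * ?V))"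
        by (rule trans[OF frobenius_inner_mult_right[of "?V * W" n S U]
              frobenius_inner_mult_left[of W n "S * ?V" ?V, unfolded VV]]) (use Uc Vc W Sc in simp_all)
      also have "U * (S * ?V) = Z"
        using cancel2[OF Zc] assoc_mult_mat[OF Uc Sc Vc] by (simp add: S_def)
      finally show ?thesis by simp
    qed
    have "frobenius_inner n Y Z = frobenius_inner n (pinching n m P T) S"
      using tr[OF Yc] by (simp add: VYU)
    also have "\<dots> = frobenius_inner n X Z"
      using frobenius_inner_pinching[OF P Tc Sc] tr[OF X] by (simp add: PS T_def)
    finally show ?thesis by (simp add: frobenius_inner_diff_left[OF X Yc])
  qed
  have pyth: "(frobenius_norm (X - Z))\<^sup>2 = (frobenius_norm (X - Y))\<^sup>2 + (frobenius_norm (Z - Y))\<^sup>2"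
    if Z: "Z \<in> block_algebra n m P U" for Z
  proof -
    have Zc: "Z \<in> carrier_mat n n" using Z by (simp add: block_algebra_def)
    let ?A = "X - Y" and ?B = "Z - Y"
    have c: "?A \<in> carrier_mat n n" "?B \<in> carrier_mat n n" using X Yc Zc by auto
    have XZ: "X - Z = ?A - ?B" by (rule eq_matI) (use X Yc Zc in auto)
    have AB: "frobenius_inner n ?A ?B = 0"
      by (simp add: frobenius_inner_diff_right[OF Zc Yc] orth[OF Z] orth[OF YM])
    then have BA: "frobenius_inner n ?B ?A = 0" by (subst frobenius_inner_cnj) simp
    have "frobenius_inner n (X - Z) (X - Z) = frobenius_inner n ?A ?A + frobenius_inner n ?B ?B"
      unfolding XZ
      by (simp add: frobenius_inner_diff_left[OF c] frobenius_inner_diff_right[OF c] AB BA)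
    then have "complex_of_real ((frobenius_norm (X - Z))\<^sup>2) =
        of_real ((frobenius_norm ?A)\<^sup>2 + (frobenius_norm ?B)\<^sup>2)"
      by (simp add: frobenius_inner_self[OF c(1)] frobenius_inner_self[OF c(2)]
          frobenius_inner_self[OF minus_carrier_mat[OF Zc]] del: of_real_power)
    then show ?thesis unfolding of_real_eq_iff .
  qed
  show min: "frobenius_norm (X - Y) \<le> frobenius_norm (X - Z)"
    if Z: "Z \<in> block_algebra n m P U" for Z
  proof (rule power2_le_imp_le)
    show "(frobenius_norm (X - Y))\<^sup>2 \<le> (frobenius_norm (X - Z))\<^sup>2"
      unfolding pyth[OF Z] by simp
  qed simp
  show uniq: "Z = Y"
    if Z: "Z \<in> block_algebra n m P U" and le: "frobenius_norm (X - Z) \<le> frobenius_norm (X - Y)" for Z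
  proof -
    have "(frobenius_norm (X - Z))\<^sup>2 \<le> (frobenius_norm (X - Y))\<^sup>2"
      using le by (rule power_mono) simp
    then have "(frobenius_norm (Z - Y))\<^sup>2 \<le> 0" unfolding pyth[OF Z] by simp
    then have "frobenius_norm (Z - Y) = 0" by simp
    moreover have "Z \<in> carrier_mat n n" using Z by (simp add: block_algebra_def)
    ultimately show ?thesis using Yc frobenius_norm_diff_eq_0 by blast
  qed
  show "frobenius_precond n m P U X = Y"
    unfolding frobenius_precond_def
  proof (rule the_equality)
    show "Y \<in> block_algebra n m P U \<and>
        (\<forall>Z\<in>block_algebra n m P U. frobenius_norm (X - Y) \<le> frobenius_norm (X - Z))"
      using YM min by blast
  next
    fix W
    assume W: "W \<in> block_algebra n m P U \<and>
        (\<forall>Z\<in>block_algebra n m P U. frobenius_norm (X - W) \<le> frobenius_norm (X - Z))"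
    show "W = Y"
      by (rule uniq) (use W YM in blast)+
  qed
qed

end

theory Submission
  imports
    Defs
    "HOL-Analysis.L2_Norm"
    "HOL-Analysis.Complex_Transcendental"
    "HOL-Analysis.Weierstrass_Theorems"
begin

text \<open>
  Call a sequence of matrices null if, for every \<open>\<epsilon> > 0\<close>, it is the sum of a part with Frobenius norm
  bounded independently of the size \<open>n\<close> and a part of operator norm at most \<open>\<epsilon>\<close>, for all large \<open>n\<close>. The null
  sequences form a linear space that is closed under adjoints, under multiplication by bounded
  sequences, and under limits in the operator norm that are uniform in \<open>n\<close>. For a
  bounded difference \<open>X - Y\<close>, convergence of \<open>X\<close> to \<open>Y\<close> in strong cluster means that \<open>X - Y\<close> is null
  (\<open>strong_clusterI\<close>, \<open>strong_clusterD\<close>): diagonalise \<open>(X - Y)\<^sup>*(X - Y)\<close> and count eigenvalues.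

  The preconditioner is the pinching \<open>\<Phi>\<close> by the projections \<open>U P\<^sub>k U\<^sup>*\<close>. It contracts both the Frobenius
  norm and the operator norm, so it preserves null sequences, and it commutes with adjoints. Its image is
  an algebra on which it acts as the identity. Toeplitz matrices satisfy \<open>\<parallel>T f\<parallel> \<le> sup \<bar>f\<bar>\<close>, and the
  semicommutator \<open>T(fg) - T f T g\<close> is null for all continuous periodic symbols
  (\<open>cluster_null_semicommutator\<close>): for an exponential \<open>g\<close> only a fixed number of columns is
  nonzero, and trigonometric polynomials are dense.

  Let \<open>B\<close> be the set of symbols \<open>f\<close> for which \<open>\<Phi>(T f) - T f\<close> is null. It is a closed subspace that is stable under
  conjugation. It is also closed under products: modulo null sequences,
  \<open>T(fg)\<close> equals \<open>T f T g\<close>, hence \<open>\<Phi>(T f)\<Phi>(T g)\<close>; the latter is fixed by \<open>\<Phi>\<close>, and so \<open>T(fg)\<close> is fixed by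
  \<open>\<Phi>\<close> modulo null sequences (\<open>pinching_compatible_mult\<close>). Thus \<open>B\<close> is a C*-algebra; it contains the
  generators, and therefore all of the C*-algebra that they generate.
\<close>

section \<open>Frobenius and operator norms, and null sequences\<close>

lemmas assoc_square = assoc_mult_mat[where ?n\<^sub>1 = n and ?n\<^sub>2 = n and ?n\<^sub>3 = n and ?n\<^sub>4 = n for n]
lemmas mult_square = mult_carrier_mat[where nr = n and n = n and nc = n for n]

lemma dim_mat_adjoint [simp]:
  "dim_row (mat_adjoint A) = dim_col A" "dim_col (mat_adjoint A) = dim_row A"
  by (simp_all add: mat_adjoint_def)

lemma mat_adjoint_adjoint [simp]:
  fixes A :: "complex mat"
  shows "mat_adjoint (mat_adjoint A) = A"
proof (rule eq_matI)
  fix i j assume ij: "i < dim_row A" "j < dim_col A"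
  have A: "A \<in> carrier_mat (dim_row A) (dim_col A)" by simp
  show "mat_adjoint (mat_adjoint A) $$ (i, j) = A $$ (i, j)"
    using mat_adjoint_index[OF mat_adjoint_carrier[OF A] ij] mat_adjoint_index[OF A ij(2,1)] by simp
qed simp_all

lemma mat_adjoint_mult:
  fixes A B :: "complex mat"
  assumes A: "A \<in> carrier_mat n n" and B: "B \<in> carrier_mat n n"
  shows "mat_adjoint (A * B) = mat_adjoint B * mat_adjoint A"
proof (rule eq_matI)
  note c = mat_adjoint_carrier[OF A] mat_adjoint_carrier[OF B]
  fix i j assume "i < dim_row (mat_adjoint B * mat_adjoint A)"
    "j < dim_col (mat_adjoint B * mat_adjoint A)"
  then have ij: "i < n" "j < n" using A B by auto
  show "mat_adjoint (A * B) $$ (i, j) = (mat_adjoint B * mat_adjoint A) $$ (i, j)"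
    unfolding mat_adjoint_index[OF mult_square[OF A B] ij]
      mult_mat_index_sum[OF A B ij(2,1)] mult_mat_index_sum[OF c(2,1) ij]
    using ij by (simp add: mat_adjoint_index[OF A] mat_adjoint_index[OF B] mult.commute)
qed simp_all

lemma mat_adjoint_add:
  fixes A B :: "complex mat"
  assumes A: "A \<in> carrier_mat n n" and B: "B \<in> carrier_mat n n"
  shows "mat_adjoint (A + B) = mat_adjoint A + mat_adjoint B"
  by (rule eq_matI)
    (use A B in \<open>simp_all add: mat_adjoint_index[OF A] mat_adjoint_index[OF B]
        mat_adjoint_index[OF add_carrier_mat[OF B, of A]]\<close>)

lemma mat_adjoint_diff:
  fixes A B :: "complex mat"
  assumes A: "A \<in> carrier_mat n n" and B: "B \<in> carrier_mat n n"
  shows "mat_adjoint (A - B) = mat_adjoint A - mat_adjoint B"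
  by (rule eq_matI)
    (use A B in \<open>simp_all add: mat_adjoint_index[OF A] mat_adjoint_index[OF B]
        mat_adjoint_index[OF minus_carrier_mat[OF B, of A]]\<close>)

lemma mat_adjoint_msum:
  assumes F: "\<And>k. k < m \<Longrightarrow> F k \<in> carrier_mat n n"
  shows "mat_adjoint (msum n m F) = msum n m (\<lambda>k. mat_adjoint (F k))"
proof (rule eq_matI)
  fix i j assume "i < dim_row (msum n m (\<lambda>k. mat_adjoint (F k)))"
    "j < dim_col (msum n m (\<lambda>k. mat_adjoint (F k)))"
  then have ij: "i < n" "j < n" by (auto simp: msum_def)
  have "(\<Sum>k<m. cnj (F k $$ (j, i))) = (\<Sum>k<m. mat_adjoint (F k) $$ (i, j))"
    by (rule sum.cong) (use ij mat_adjoint_index[OF F] in auto)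
  then show "mat_adjoint (msum n m F) $$ (i, j) = msum n m (\<lambda>k. mat_adjoint (F k)) $$ (i, j)"
    unfolding mat_adjoint_index[OF msum_carrier ij] using ij by (simp add: msum_def)
qed (simp_all add: msum_def)

lemma frobenius_norm_square:
  assumes "A \<in> carrier_mat n n"
  shows "(frobenius_norm A)\<^sup>2 = (\<Sum>i<n. \<Sum>j<n. (cmod (A $$ (i, j)))\<^sup>2)"
  using assms by (simp add: frobenius_norm_def sum_nonneg)

lemma frobenius_norm_L2_set:
  assumes "A \<in> carrier_mat n n"
  shows "frobenius_norm A = L2_set (\<lambda>ij. cmod (A $$ ij)) ({..<n} \<times> {..<n})"
  using assms by (simp add: frobenius_norm_def L2_set_def sum.cartesian_product split_def)

lemma frobenius_norm_triangle:
  assumes A: "A \<in> carrier_mat n n" and B: "B \<in> carrier_mat n n"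
  shows "frobenius_norm (A + B) \<le> frobenius_norm A + frobenius_norm B"
proof -
  have "frobenius_norm (A + B) \<le>
      L2_set (\<lambda>ij. cmod (A $$ ij) + cmod (B $$ ij)) ({..<n} \<times> {..<n})"
    unfolding frobenius_norm_L2_set[OF add_carrier_mat[OF B, of A]]
    by (rule L2_set_mono) (use A B in \<open>auto simp: norm_triangle_ineq\<close>)
  also have "\<dots> \<le> frobenius_norm A + frobenius_norm B"
    unfolding frobenius_norm_L2_set[OF A] frobenius_norm_L2_set[OF B] by (rule L2_set_triangle_ineq)
  finally show ?thesis .
qed

lemma frobenius_norm_smult [simp]: "frobenius_norm (c \<cdot>\<^sub>m A) = cmod c * frobenius_norm A"
  by (simp add: frobenius_norm_def norm_mult power_mult_distrib real_sqrt_mult flip: sum_distrib_left)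

lemma frobenius_norm_adjoint [simp]:
  assumes A: "A \<in> carrier_mat n n"
  shows "frobenius_norm (mat_adjoint A) = frobenius_norm A"
proof (rule power2_eq_imp_eq)
  have "(frobenius_norm (mat_adjoint A))\<^sup>2 = (\<Sum>i<n. \<Sum>j<n. (cmod (A $$ (j, i)))\<^sup>2)"
    unfolding frobenius_norm_square[OF mat_adjoint_carrier[OF A]]
    by (intro sum.cong refl) (simp add: mat_adjoint_index[OF A])
  also have "\<dots> = (frobenius_norm A)\<^sup>2"
    unfolding frobenius_norm_square[OF A] by (rule sum.swap)
  finally show "(frobenius_norm (mat_adjoint A))\<^sup>2 = (frobenius_norm A)\<^sup>2" .
qed simp_all

lemma frobenius_inner_cauchy_schwarz:
  assumes A: "A \<in> carrier_mat n n" and B: "B \<in> carrier_mat n n"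
  shows "cmod (frobenius_inner n A B) \<le> frobenius_norm A * frobenius_norm B"
proof -
  have "frobenius_inner n A B = (\<Sum>ij\<in>{..<n} \<times> {..<n}. cnj (A $$ ij) * B $$ ij)"
    by (simp add: frobenius_inner_def sum.cartesian_product split_def)
  then have "cmod (frobenius_inner n A B) \<le> (\<Sum>ij\<in>{..<n} \<times> {..<n}. \<bar>cmod (A $$ ij)\<bar> * \<bar>cmod (B $$ ij)\<bar>)"
    by (auto intro!: order_trans[OF norm_sum] sum_mono simp: norm_mult)
  also have "\<dots> \<le> frobenius_norm A * frobenius_norm B"
    unfolding frobenius_norm_L2_set[OF A] frobenius_norm_L2_set[OF B] by (rule L2_set_mult_ineq)
  finally show ?thesis .
qed

text \<open>The operator norm is expressed by left multiplication on matrices with the Frobenius norm: a matrix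
  acts on each column of \<open>B\<close> separately, so the best constant \<open>c\<close> is the spectral norm of \<open>A\<close>. In this form
  the Frobenius inner product is the only inner product that has to be set up.\<close>

definition op_bound :: "nat \<Rightarrow> real \<Rightarrow> complex mat \<Rightarrow> bool" where
  "op_bound n c A \<longleftrightarrow> A \<in> carrier_mat n n \<and> 0 \<le> c \<and>
     (\<forall>B\<in>carrier_mat n n. frobenius_norm (A * B) \<le> c * frobenius_norm B)"

lemma op_bound_zero: "0 \<le> c \<Longrightarrow> op_bound n c (0\<^sub>m n n)"
  by (auto simp: op_bound_def frobenius_norm_def intro!: mult_nonneg_nonneg sum_nonneg)

lemma op_boundD:
  assumes "op_bound n c A"
  shows "A \<in> carrier_mat n n" "0 \<le> c"
    "B \<in> carrier_mat n n \<Longrightarrow> frobenius_norm (A * B) \<le> c * frobenius_norm B"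
  using assms by (auto simp: op_bound_def)

lemma op_bound_mono: "op_bound n c A \<Longrightarrow> c \<le> d \<Longrightarrow> op_bound n d A"
  unfolding op_bound_def by (meson frobenius_norm_nonneg mult_right_mono order_trans)

lemma op_bound_add:
  assumes A: "op_bound n c A" and B: "op_bound n d B"
  shows "op_bound n (c + d) (A + B)"
  unfolding op_bound_def
proof (intro conjI ballI)
  note Ac = op_boundD(1)[OF A] and Bc = op_boundD(1)[OF B]
  show "A + B \<in> carrier_mat n n" using Ac Bc by simp
  show "0 \<le> c + d" using op_boundD(2)[OF A] op_boundD(2)[OF B] by simp
  fix C :: "complex mat" assume C: "C \<in> carrier_mat n n"
  have "frobenius_norm ((A + B) * C) \<le> frobenius_norm (A * C) + frobenius_norm (B * C)"
    unfolding add_mult_distrib_mat[OF Ac Bc C]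
    by (rule frobenius_norm_triangle[OF mult_square[OF Ac C] mult_square[OF Bc C]])
  also have "\<dots> \<le> (c + d) * frobenius_norm C"
    using op_boundD(3)[OF A C] op_boundD(3)[OF B C] by (simp add: distrib_right)
  finally show "frobenius_norm ((A + B) * C) \<le> (c + d) * frobenius_norm C" .
qed

lemma op_bound_mult:
  assumes A: "op_bound n c A" and B: "op_bound n d B"
  shows "op_bound n (c * d) (A * B)"
  unfolding op_bound_def
proof (intro conjI ballI)
  note Ac = op_boundD(1)[OF A] and Bc = op_boundD(1)[OF B]
  show "A * B \<in> carrier_mat n n" using Ac Bc by simp
  show "0 \<le> c * d" using op_boundD(2)[OF A] op_boundD(2)[OF B] by simp
  fix C :: "complex mat" assume C: "C \<in> carrier_mat n n"
  have "frobenius_norm (A * B * C) \<le> c * frobenius_norm (B * C)"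
    using op_boundD(3)[OF A, of "B * C"] Ac Bc C by (simp add: assoc_square)
  also have "\<dots> \<le> c * (d * frobenius_norm C)"
    by (intro mult_left_mono op_boundD(3)[OF B C] op_boundD(2)[OF A])
  finally show "frobenius_norm (A * B * C) \<le> c * d * frobenius_norm C" by (simp add: mult.assoc)
qed

lemma op_bound_smult:
  assumes A: "op_bound n c A"
  shows "op_bound n (cmod a * c) (a \<cdot>\<^sub>m A)"
  unfolding op_bound_def
proof (intro conjI ballI)
  fix C :: "complex mat" assume C: "C \<in> carrier_mat n n"
  show "frobenius_norm (a \<cdot>\<^sub>m A * C) \<le> cmod a * c * frobenius_norm C"
    using op_boundD(3)[OF A C] mult_smult_assoc_mat[OF op_boundD(1)[OF A] C, of a]
    by (simp add: mult.assoc mult_left_mono)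
qed (use op_boundD[OF A] in auto)

lemma op_bound_diff:
  assumes A: "op_bound n c A" and B: "op_bound n d B"
  shows "op_bound n (c + d) (A - B)"
proof -
  have "A - B = A + (- 1) \<cdot>\<^sub>m B" by (rule eq_matI) (use op_boundD(1)[OF A] op_boundD(1)[OF B] in auto)
  then show ?thesis using op_bound_add[OF A op_bound_smult[OF B, of "- 1"]] by simp
qed

text \<open>\<open>\<parallel>A\<^sup>*B\<parallel>\<^sup>2 = \<langle>B, A(A\<^sup>*B)\<rangle> \<le> \<parallel>B\<parallel> c \<parallel>A\<^sup>*B\<parallel>\<close> by Cauchy-Schwarz; then cancel one factor.\<close>

lemma op_bound_adjoint:
  assumes A: "op_bound n c A"
  shows "op_bound n c (mat_adjoint A)"
  unfolding op_bound_def
proof (intro conjI ballI)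
  note Ac = op_boundD(1)[OF A]
  note Vc = mat_adjoint_carrier[OF Ac]
  show "mat_adjoint A \<in> carrier_mat n n" "0 \<le> c" using Vc op_boundD(2)[OF A] by auto
  fix B :: "complex mat" assume B: "B \<in> carrier_mat n n"
  let ?x = "frobenius_norm (mat_adjoint A * B)"
  have VB: "mat_adjoint A * B \<in> carrier_mat n n" using Vc B by simp
  have "?x\<^sup>2 = cmod (frobenius_inner n (mat_adjoint A * B) (mat_adjoint A * B))"
    unfolding frobenius_inner_self[OF VB] norm_of_real by simp
  also have "\<dots> = cmod (frobenius_inner n B (A * (mat_adjoint A * B)))"
    by (simp add: frobenius_inner_mult_left[OF B VB Vc] mat_adjoint_adjoint)
  also have "\<dots> \<le> frobenius_norm B * frobenius_norm (A * (mat_adjoint A * B))"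
    by (rule frobenius_inner_cauchy_schwarz[OF B mult_square[OF Ac VB]])
  also have "\<dots> \<le> frobenius_norm B * (c * ?x)"
    by (intro mult_left_mono op_boundD(3)[OF A VB]) simp
  finally have *: "?x * ?x \<le> (c * frobenius_norm B) * ?x" by (simp add: power2_eq_square mult_ac)
  show "?x \<le> c * frobenius_norm B"
  proof (cases "?x = 0")
    case True
    then show ?thesis using op_boundD(2)[OF A] by simp
  next
    case False
    then have "?x > 0" using frobenius_norm_nonneg[of "mat_adjoint A * B"] by linarith
    then show ?thesis using * by (rule mult_right_le_imp_le[rotated])
  qed
qed

lemma frobenius_norm_mult_op_bound:
  assumes A: "op_bound n c A" and K: "K \<in> carrier_mat n n"
  shows "frobenius_norm (K * A) \<le> c * frobenius_norm K"
proof -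
  note Ac = op_boundD(1)[OF A]
  have "frobenius_norm (K * A) = frobenius_norm (mat_adjoint A * mat_adjoint K)"
    using frobenius_norm_adjoint[OF mult_square[OF K Ac]] mat_adjoint_mult[OF K Ac] by simp
  also have "\<dots> \<le> c * frobenius_norm K"
    using op_boundD(3)[OF op_bound_adjoint[OF A] mat_adjoint_carrier[OF K]] K by simp
  finally show ?thesis .
qed

text \<open>The additive form of clustering at zero. The bounded part is measured in the Frobenius norm rather than
  by its rank, because pinchings contract the Frobenius norm but may turn a matrix of rank one into one
  of full rank. For bounded sequences the two descriptions of a cluster agree; see \<open>strong_clusterI\<close> and
  \<open>strong_clusterD\<close> below.\<close>

definition cluster_null :: "(nat \<Rightarrow> complex mat) \<Rightarrow> bool" where
  "cluster_null X \<longleftrightarrow> (\<forall>\<epsilon>>0. \<exists>C N. \<forall>n>N. \<exists>K E. X n = K + E \<and>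
     K \<in> carrier_mat n n \<and> frobenius_norm K \<le> C \<and> op_bound n \<epsilon> E)"

definition op_bounded :: "(nat \<Rightarrow> complex mat) \<Rightarrow> bool" where
  "op_bounded X \<longleftrightarrow> (\<exists>c. \<forall>n. op_bound n c (X n))"

lemma cluster_nullE:
  assumes "cluster_null X" "0 < \<epsilon>"
  obtains C N where "0 \<le> C" "\<And>n. n > N \<Longrightarrow> \<exists>K E. X n = K + E \<and>
     K \<in> carrier_mat n n \<and> frobenius_norm K \<le> C \<and> op_bound n \<epsilon> E"
proof -
  obtain C N where *: "\<And>n. n > N \<Longrightarrow> \<exists>K E. X n = K + E \<and>
     K \<in> carrier_mat n n \<and> frobenius_norm K \<le> C \<and> op_bound n \<epsilon> E"
    using assms unfolding cluster_null_def by meson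
  then obtain K :: "complex mat" where "frobenius_norm K \<le> C" by (meson lessI)
  then have "0 \<le> C" using frobenius_norm_nonneg order_trans by blast
  with * that show ?thesis by blast
qed

lemma cluster_null_add:
  assumes X: "cluster_null X" and Y: "cluster_null Y"
  shows "cluster_null (\<lambda>n. X n + Y n)"
  unfolding cluster_null_def
proof (intro allI impI)
  fix \<epsilon> :: real assume "\<epsilon> > 0"
  then have e: "\<epsilon> / 2 > 0" by simp
  obtain C N where C: "\<And>n. n > N \<Longrightarrow> \<exists>K E. X n = K + E \<and>
     K \<in> carrier_mat n n \<and> frobenius_norm K \<le> C \<and> op_bound n (\<epsilon> / 2) E"
    using cluster_nullE[OF X e] by metis
  obtain D M where D: "\<And>n. n > M \<Longrightarrow> \<exists>K E. Y n = K + E \<and>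
     K \<in> carrier_mat n n \<and> frobenius_norm K \<le> D \<and> op_bound n (\<epsilon> / 2) E"
    using cluster_nullE[OF Y e] by metis
  show "\<exists>C N. \<forall>n>N. \<exists>K E. X n + Y n = K + E \<and>
     K \<in> carrier_mat n n \<and> frobenius_norm K \<le> C \<and> op_bound n \<epsilon> E"
  proof (rule exI[of _ "C + D"], rule exI[of _ "max N M"], intro allI impI)
    fix n assume "n > max N M"
    then obtain K E K' E' where *: "X n = K + E" "Y n = K' + E'" "K \<in> carrier_mat n n"
      "K' \<in> carrier_mat n n" "frobenius_norm K \<le> C" "frobenius_norm K' \<le> D"
      "op_bound n (\<epsilon> / 2) E" "op_bound n (\<epsilon> / 2) E'"
      using C[of n] D[of n] by auto
    have "X n + Y n = (K + K') + (E + E')"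
      by (rule eq_matI) (use * op_boundD(1)[OF *(7)] op_boundD(1)[OF *(8)] in auto)
    moreover have "frobenius_norm (K + K') \<le> C + D"
      using frobenius_norm_triangle[OF *(3,4)] *(5,6) by simp
    moreover have "op_bound n \<epsilon> (E + E')" using op_bound_add[OF *(7,8)] by simp
    ultimately show "\<exists>K E. X n + Y n = K + E \<and>
     K \<in> carrier_mat n n \<and> frobenius_norm K \<le> C + D \<and> op_bound n \<epsilon> E"
      using *(3,4) by (meson add_carrier_mat)
  qed
qed

lemma cluster_null_mult_left:
  assumes A: "op_bounded A" and X: "cluster_null X"
  shows "cluster_null (\<lambda>n. A n * X n)"
  unfolding cluster_null_def
proof (intro allI impI)
  fix \<epsilon> :: real assume e0: "\<epsilon> > 0"
  obtain c where "\<And>n. op_bound n c (A n)" using A by (auto simp: op_bounded_def)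
  \<comment> \<open>A strictly positive bound, by which \<open>\<epsilon>\<close> can be divided.\<close>
  then have c: "\<And>n. op_bound n (\<bar>c\<bar> + 1) (A n)" by (rule op_bound_mono) simp
  have e: "\<epsilon> / (\<bar>c\<bar> + 1) > 0" using e0 by (simp add: divide_pos_pos)
  obtain C N where C: "\<And>n. n > N \<Longrightarrow> \<exists>K E. X n = K + E \<and>
     K \<in> carrier_mat n n \<and> frobenius_norm K \<le> C \<and> op_bound n (\<epsilon> / (\<bar>c\<bar> + 1)) E"
    using cluster_nullE[OF X e] by metis
  show "\<exists>C N. \<forall>n>N. \<exists>K E. A n * X n = K + E \<and>
     K \<in> carrier_mat n n \<and> frobenius_norm K \<le> C \<and> op_bound n \<epsilon> E"
  proof (rule exI[of _ "(\<bar>c\<bar> + 1) * C"], rule exI[of _ N], intro allI impI)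
    fix n assume "n > N"
    then obtain K E where *: "X n = K + E" "K \<in> carrier_mat n n"
       "frobenius_norm K \<le> C" "op_bound n (\<epsilon> / (\<bar>c\<bar> + 1)) E"
      using C[of n] by auto
    note Ac = op_boundD(1)[OF c[of n]]
    have "A n * X n = A n * K + A n * E"
      unfolding *(1) by (rule mult_add_distrib_mat[OF Ac *(2) op_boundD(1)[OF *(4)]])
    moreover have "frobenius_norm (A n * K) \<le> (\<bar>c\<bar> + 1) * C"
      by (rule order_trans[OF op_boundD(3)[OF c *(2)]]) (use *(3) in \<open>simp add: mult_left_mono\<close>)
    moreover have "op_bound n \<epsilon> (A n * E)"
      using op_bound_mult[OF c *(4)] by (simp add: nonzero_eq_divide_eq)
    ultimately show "\<exists>K E. A n * X n = K + E \<and>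
     K \<in> carrier_mat n n \<and> frobenius_norm K \<le> (\<bar>c\<bar> + 1) * C \<and> op_bound n \<epsilon> E"
      using mult_square[OF Ac *(2)] by blast
  qed
qed

lemma cluster_null_adjoint:
  assumes X: "cluster_null X"
  shows "cluster_null (\<lambda>n. mat_adjoint (X n))"
  unfolding cluster_null_def
proof (intro allI impI)
  fix \<epsilon> :: real assume e: "\<epsilon> > 0"
  obtain C N where C: "\<And>n. n > N \<Longrightarrow> \<exists>K E. X n = K + E \<and>
     K \<in> carrier_mat n n \<and> frobenius_norm K \<le> C \<and> op_bound n \<epsilon> E"
    using cluster_nullE[OF X e] by metis
  show "\<exists>C N. \<forall>n>N. \<exists>K E. mat_adjoint (X n) = K + E \<and>
     K \<in> carrier_mat n n \<and> frobenius_norm K \<le> C \<and> op_bound n \<epsilon> E"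
  proof (rule exI[of _ C], rule exI[of _ N], intro allI impI)
    fix n assume "n > N"
    then obtain K E where *: "X n = K + E" "K \<in> carrier_mat n n"
       "frobenius_norm K \<le> C" "op_bound n \<epsilon> E"
      using C[of n] by auto
    have "mat_adjoint (X n) = mat_adjoint K + mat_adjoint E"
      unfolding *(1) by (rule mat_adjoint_add[OF *(2) op_boundD(1)[OF *(4)]])
    then show "\<exists>K E. mat_adjoint (X n) = K + E \<and>
     K \<in> carrier_mat n n \<and> frobenius_norm K \<le> C \<and> op_bound n \<epsilon> E"
      using *(2,3) op_bound_adjoint[OF *(4)] frobenius_norm_adjoint[OF *(2)]
        mat_adjoint_carrier[OF *(2)] by metis
  qed
qed

lemma cluster_null_of_frobenius_bound:
  assumes X: "\<And>n. X n \<in> carrier_mat n n" and C: "\<And>n. frobenius_norm (X n) \<le> C"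
  shows "cluster_null X"
  unfolding cluster_null_def
proof (intro allI impI exI conjI)
  fix \<epsilon> :: real and n assume "\<epsilon> > 0"
  then show "op_bound n \<epsilon> (0\<^sub>m n n)" by (simp add: op_bound_zero)
  show "X n = X n + 0\<^sub>m n n" using X by simp
qed (rule X C)+

lemma op_bounded_carrier: "op_bounded X \<Longrightarrow> X n \<in> carrier_mat n n"
  by (auto simp: op_bounded_def op_bound_def)

lemma op_bounded_adjoint: "op_bounded X \<Longrightarrow> op_bounded (\<lambda>n. mat_adjoint (X n))"
  unfolding op_bounded_def using op_bound_adjoint by blast

lemma op_bounded_diff: "op_bounded X \<Longrightarrow> op_bounded Y \<Longrightarrow> op_bounded (\<lambda>n. X n - Y n)"
  unfolding op_bounded_def using op_bound_diff by blast

lemma op_bounded_scalar: "op_bounded (\<lambda>n. a \<cdot>\<^sub>m 1\<^sub>m n)"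
  unfolding op_bounded_def
proof (intro exI allI)
  fix n
  show "op_bound n (cmod a * 1) (a \<cdot>\<^sub>m 1\<^sub>m n)"
    by (rule op_bound_smult) (simp add: op_bound_def)
qed

lemma cluster_null_carrier:
  assumes X: "cluster_null X"
  obtains N where "\<And>n. n > N \<Longrightarrow> X n \<in> carrier_mat n n"
proof -
  obtain C N where N: "\<And>n. n > N \<Longrightarrow> \<exists>K E. X n = K + E \<and>
     K \<in> carrier_mat n n \<and> frobenius_norm K \<le> C \<and> op_bound n 1 E"
    using cluster_nullE[OF X, of 1] by (metis less_numeral_extra(1))
  show ?thesis
  proof (rule that)
    fix n assume "n > N"
    then show "X n \<in> carrier_mat n n" using N op_boundD(1) add_carrier_mat by metis
  qed
qed

lemma cluster_null_cong_eventually: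
  assumes "cluster_null X" and "\<And>n. n > N \<Longrightarrow> Y n = X n"
  shows "cluster_null Y"
  unfolding cluster_null_def
proof (intro allI impI)
  fix \<epsilon> :: real assume e: "\<epsilon> > 0"
  obtain C M where C: "\<And>n. n > M \<Longrightarrow> \<exists>K E. X n = K + E \<and>
     K \<in> carrier_mat n n \<and> frobenius_norm K \<le> C \<and> op_bound n \<epsilon> E"
    using cluster_nullE[OF assms(1) e] by metis
  show "\<exists>C N. \<forall>n>N. \<exists>K E. Y n = K + E \<and>
     K \<in> carrier_mat n n \<and> frobenius_norm K \<le> C \<and> op_bound n \<epsilon> E"
    by (rule exI[of _ C], rule exI[of _ "max M N"]) (use C assms(2) in auto)
qed

lemma cluster_null_mult_right:
  assumes A: "op_bounded A" and X: "cluster_null X"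
  shows "cluster_null (\<lambda>n. X n * A n)"
proof -
  obtain N where N: "\<And>n. n > N \<Longrightarrow> X n \<in> carrier_mat n n"
    using cluster_null_carrier[OF X] by metis
  have "cluster_null (\<lambda>n. mat_adjoint (mat_adjoint (A n) * mat_adjoint (X n)))"
    by (intro cluster_null_adjoint cluster_null_mult_left op_bounded_adjoint A X)
  then show ?thesis
  proof (rule cluster_null_cong_eventually)
    fix n assume "n > N"
    then show "X n * A n = mat_adjoint (mat_adjoint (A n) * mat_adjoint (X n))"
      using N op_bounded_carrier[OF A, of n]
      by (simp add: mat_adjoint_mult[where n = n])
  qed
qed

lemma cluster_null_smult:
  assumes X: "cluster_null X"
  shows "cluster_null (\<lambda>n. a \<cdot>\<^sub>m X n)"
proof -
  obtain N where N: "\<And>n. n > N \<Longrightarrow> X n \<in> carrier_mat n n" using cluster_null_carrier[OF X] by metis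
  show ?thesis
  proof (rule cluster_null_cong_eventually[OF cluster_null_mult_left[OF op_bounded_scalar X]])
    fix n assume "n > N"
    then have Xn: "X n \<in> carrier_mat n n" by (rule N)
    show "a \<cdot>\<^sub>m X n = a \<cdot>\<^sub>m 1\<^sub>m n * X n"
      by (simp only: mult_smult_assoc_mat[OF one_carrier_mat Xn] left_mult_one_mat[OF Xn])
  qed
qed

lemma cluster_null_diff:
  assumes X: "cluster_null X" and Y: "cluster_null Y"
  shows "cluster_null (\<lambda>n. X n - Y n)"
proof -
  obtain N where N: "\<And>n. n > N \<Longrightarrow> Y n \<in> carrier_mat n n"
    using cluster_null_carrier[OF Y] by metis
  obtain M where M: "\<And>n. n > M \<Longrightarrow> X n \<in> carrier_mat n n"
    using cluster_null_carrier[OF X] by metis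
  have "cluster_null (\<lambda>n. X n + (- 1) \<cdot>\<^sub>m 1\<^sub>m n * Y n)"
    by (intro cluster_null_add X cluster_null_mult_left Y op_bounded_scalar)
  then show ?thesis
  proof (rule cluster_null_cong_eventually)
    fix n assume n: "n > max N M"
    then have c: "X n \<in> carrier_mat n n" "Y n \<in> carrier_mat n n" using N M by auto
    have "(- 1) \<cdot>\<^sub>m 1\<^sub>m n * Y n = (- 1) \<cdot>\<^sub>m Y n"
      using c by (simp add: mult_smult_assoc_mat[OF one_carrier_mat c(2)])
    then show "X n - Y n = X n + (- 1) \<cdot>\<^sub>m 1\<^sub>m n * Y n"
      using c by (intro eq_matI) auto
  qed
qed

text \<open>Limits in the operator norm, uniformly in the matrix size, stay clustered at zero: the
  approximation error is absorbed into the part of small operator norm.\<close>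

lemma cluster_null_limit:
  assumes "\<And>\<epsilon>. \<epsilon> > 0 \<Longrightarrow> \<exists>Y. cluster_null Y \<and> (\<forall>n. Y n \<in> carrier_mat n n \<and> op_bound n \<epsilon> (X n - Y n))"
    and Xc: "\<And>n. X n \<in> carrier_mat n n"
  shows "cluster_null X"
  unfolding cluster_null_def
proof (intro allI impI)
  fix \<epsilon> :: real assume "\<epsilon> > 0"
  then have e: "\<epsilon> / 2 > 0" by simp
  obtain Y where Y: "cluster_null Y" and Yc: "\<And>n. Y n \<in> carrier_mat n n"
    and XY: "\<And>n. op_bound n (\<epsilon> / 2) (X n - Y n)"
    using assms(1)[OF e] by blast
  obtain C N where C: "\<And>n. n > N \<Longrightarrow> \<exists>K E. Y n = K + E \<and>
     K \<in> carrier_mat n n \<and> frobenius_norm K \<le> C \<and> op_bound n (\<epsilon> / 2) E"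
    using cluster_nullE[OF Y e] by metis
  show "\<exists>C N. \<forall>n>N. \<exists>K E. X n = K + E \<and>
     K \<in> carrier_mat n n \<and> frobenius_norm K \<le> C \<and> op_bound n \<epsilon> E"
  proof (rule exI[of _ C], rule exI[of _ N], intro allI impI)
    fix n assume "n > N"
    then obtain K E where *: "Y n = K + E" "K \<in> carrier_mat n n"
       "frobenius_norm K \<le> C" "op_bound n (\<epsilon> / 2) E"
      using C[of n] by auto
    have "X n = Y n + (X n - Y n)" by (rule eq_matI) (use Yc[of n] Xc[of n] in auto)
    then have "X n = K + (E + (X n - Y n))"
      using *(1,2) op_boundD(1)[OF *(4)] Xc Yc by (metis assoc_add_mat minus_carrier_mat)
    moreover have "op_bound n \<epsilon> (E + (X n - Y n))" using op_bound_add[OF *(4) XY[of n]] by simp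
    ultimately show "\<exists>K E. X n = K + E \<and>
     K \<in> carrier_mat n n \<and> frobenius_norm K \<le> C \<and> op_bound n \<epsilon> E"
      using *(2,3) by blast
  qed
qed

section \<open>Pinchings\<close>

context
  fixes n m :: nat and P :: "nat \<Rightarrow> complex mat"
  assumes P: "projection_resolution n m P"
begin

lemma projection_carrier: "k < m \<Longrightarrow> P k \<in> carrier_mat n n"
  and projection_adjoint: "k < m \<Longrightarrow> mat_adjoint (P k) = P k"
  and projection_idem: "k < m \<Longrightarrow> P k * P k = P k"
  and projection_orthogonal: "k < m \<Longrightarrow> l < m \<Longrightarrow> k \<noteq> l \<Longrightarrow> P k * P l = 0\<^sub>m n n"
  and projection_sum: "msum n m P = 1\<^sub>m n"
  using P by (auto simp: projection_resolution_def)

text \<open>Multiplying by one of the projections annihilates all the other blocks.\<close>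

lemma projection_mult_pinching:
  assumes X: "X \<in> carrier_mat n n" and l: "l < m"
  shows "P l * pinching n m P X = P l * X * P l"
proof -
  note c = projection_carrier
  have t: "P l * (P k * X * P k) = (if k = l then P l * X * P l else 0\<^sub>m n n)" if k: "k < m" for k
  proof -
    have "P l * (P k * X * P k) = (P l * P k) * X * P k"
      using c[OF l] c[OF k] X by (simp add: assoc_square[of _ n] mult_square[of _ n])
    also have "\<dots> = (if k = l then P l * X * P l else 0\<^sub>m n n)"
    proof (cases "k = l")
      case True
      then show ?thesis using projection_idem[OF l] by simp
    next
      case False
      then show ?thesis using projection_orthogonal[OF l k] c[OF k] X by simp
    qed
    finally show ?thesis .
  qed
  have "P l * pinching n m P X = msum n m (\<lambda>k. P l * (P k * X * P k))"
    unfolding pinching_def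
    by (rule mult_msum_left[OF c[OF l]]) (use c X in \<open>simp add: mult_square[of _ n]\<close>)
  also have "\<dots> = msum n m (\<lambda>k. if k = l then P l * X * P l else 0\<^sub>m n n)"
    unfolding msum_def by (rule cong_mat) (auto simp: t intro!: sum.cong)
  also have "\<dots> = P l * X * P l"
    by (rule eq_matI) (use c[OF l] X l in \<open>auto simp: msum_def if_distrib if_distribR cong: if_cong\<close>)
  finally show ?thesis .
qed

lemma pinching_adjoint:
  assumes X: "X \<in> carrier_mat n n"
  shows "mat_adjoint (pinching n m P X) = pinching n m P (mat_adjoint X)"
proof -
  have "mat_adjoint (pinching n m P X) = msum n m (\<lambda>k. mat_adjoint (P k * X * P k))"
    unfolding pinching_def
    by (rule mat_adjoint_msum) (use projection_carrier X in \<open>simp add: mult_square[of _ n]\<close>)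
  also have "\<dots> = pinching n m P (mat_adjoint X)"
    unfolding pinching_def msum_def
    by (intro cong_mat refl)
      (use projection_carrier projection_adjoint X in
        \<open>auto simp: mat_adjoint_mult[where n = n] mult_square[of _ n] assoc_square[of _ n] intro!: sum.cong\<close>)
  finally show ?thesis .
qed

text \<open>The image of a pinching is an algebra: it consists of the matrices that commute with every
  projection, and the pinching is the identity there.\<close>

lemma pinching_mult_pinching:
  assumes X: "X \<in> carrier_mat n n" and Y: "Y \<in> carrier_mat n n"
  shows "pinching n m P (pinching n m P X * pinching n m P Y) = pinching n m P X * pinching n m P Y"
    (is "pinching n m P (?X * ?Y) = _")
proof -
  note c = projection_carrier
  have "P k * (?X * ?Y) * P k = P k * X * P k * ?Y" if k: "k < m" for k
  proof -
    have Yk: "?Y * P k = P k * ?Y"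
    proof -
      have "?Y * P k = mat_adjoint (P k * pinching n m P (mat_adjoint Y))"
        using pinching_adjoint[OF mat_adjoint_carrier[OF Y]] projection_adjoint[OF k]
        by (simp add: mat_adjoint_mult[OF c[OF k] pinching_carrier])
      also have "\<dots> = P k * Y * P k"
        unfolding projection_mult_pinching[OF mat_adjoint_carrier[OF Y] k]
        using c[OF k] Y projection_adjoint[OF k]
        by (simp add: mat_adjoint_mult[where n = n] mult_square[of _ n] assoc_square[of _ n])
      finally show ?thesis using projection_mult_pinching[OF Y k] by simp
    qed
    have "P k * (?X * ?Y) * P k = P k * ?X * (?Y * P k)"
      using c[OF k] by (simp add: assoc_square[of _ n] mult_square[of _ n])
    also have "\<dots> = P k * ?X * P k * ?Y"
      unfolding Yk using c[OF k] by (simp add: assoc_square[of _ n] mult_square[of _ n])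
    also have "P k * ?X * P k = P k * X * P k"
      unfolding projection_mult_pinching[OF X k] using c[OF k] X projection_idem[OF k]
      by (simp add: assoc_square[of _ n] mult_square[of _ n])
    finally show ?thesis .
  qed
  then have "pinching n m P (?X * ?Y) = msum n m (\<lambda>k. P k * X * P k * ?Y)"
    unfolding pinching_def[of n m P "?X * ?Y"] msum_def by (intro cong_mat refl) simp
  also have "\<dots> = ?X * ?Y"
    unfolding pinching_def[of n m P X]
    by (rule mult_msum_right[symmetric, OF pinching_carrier])
      (use c X in \<open>simp add: mult_square[of _ n]\<close>)
  finally show ?thesis .
qed

lemma pinching_add:
  assumes X: "X \<in> carrier_mat n n" and Y: "Y \<in> carrier_mat n n"
  shows "pinching n m P (X + Y) = pinching n m P X + pinching n m P Y"
proof -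
  have "(P k * (X + Y) * P k) $$ (i, j) = (P k * X * P k) $$ (i, j) + (P k * Y * P k) $$ (i, j)"
    if "k < m" and ij: "i < n" "j < n" for k i j
  proof -
    note c = projection_carrier[OF that(1)]
    have "P k * (X + Y) * P k = P k * X * P k + P k * Y * P k"
      unfolding mult_add_distrib_mat[OF c X Y]
      by (rule add_mult_distrib_mat[OF mult_square[OF c X] mult_square[OF c Y] c])
    then show ?thesis using c ij by (simp del: index_mult_mat(1))
  qed
  then show ?thesis
    unfolding pinching_def msum_def
    by (intro eq_matI) (simp_all add: sum.distrib del: index_mult_mat(1))
qed

lemma pinching_diff:
  assumes X: "X \<in> carrier_mat n n" and Y: "Y \<in> carrier_mat n n"
  shows "pinching n m P (X - Y) = pinching n m P X - pinching n m P Y"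
proof -
  have "X - Y + Y = X" by (rule eq_matI) (use X Y in auto)
  then have *: "pinching n m P (X - Y) + pinching n m P Y = pinching n m P X"
    using pinching_add[OF minus_carrier_mat[OF Y] Y, of X] by simp
  show ?thesis
    unfolding *[symmetric]
    by (rule eq_matI) (simp_all add: pinching_def msum_def del: index_mult_mat(1))
qed

lemma pinching_smult:
  assumes X: "X \<in> carrier_mat n n"
  shows "pinching n m P (a \<cdot>\<^sub>m X) = a \<cdot>\<^sub>m pinching n m P X"
proof -
  have "(P k * (a \<cdot>\<^sub>m X) * P k) $$ (i, j) = a * (P k * X * P k) $$ (i, j)"
    if "k < m" and ij: "i < n" "j < n" for k i j
  proof -
    note c = projection_carrier[OF that(1)]
    have "P k * (a \<cdot>\<^sub>m X) * P k = a \<cdot>\<^sub>m (P k * X * P k)"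
      unfolding mult_smult_distrib[OF c X] by (rule mult_smult_assoc_mat[OF mult_square[OF c X] c])
    then show ?thesis using c ij by (simp del: index_mult_mat(1))
  qed
  then show ?thesis
    unfolding pinching_def msum_def
    by (intro eq_matI) (simp_all add: sum_distrib_left del: index_mult_mat(1))
qed

text \<open>Pythagoras for the orthogonal ranges of the projections.\<close>

lemma frobenius_norm_projection_sum:
  assumes B: "B \<in> carrier_mat n n"
  shows "(\<Sum>k<m. (frobenius_norm (P k * B))\<^sup>2) = (frobenius_norm B)\<^sup>2"
proof -
  have PB: "P k * B \<in> carrier_mat n n" if "k < m" for k
    using projection_carrier[OF that] B by simp
  have "complex_of_real (\<Sum>k<m. (frobenius_norm (P k * B))\<^sup>2) = (\<Sum>k<m. frobenius_inner n (P k * B) B)"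
    unfolding of_real_sum
  proof (rule sum.cong[OF refl])
    fix k assume "k \<in> {..<m}"
    then have k: "k < m" by simp
    note c = projection_carrier[OF k]
    have "complex_of_real ((frobenius_norm (P k * B))\<^sup>2) = frobenius_inner n B (P k * (P k * B))"
      using frobenius_inner_self[OF PB[OF k]] frobenius_inner_mult_left[OF B PB[OF k] c]
        projection_adjoint[OF k] by simp
    also have "P k * (P k * B) = P k * B"
      using assoc_mult_mat[OF c c B] projection_idem[OF k] by simp
    also have "frobenius_inner n B (P k * B) = frobenius_inner n (P k * B) B"
      using frobenius_inner_mult_left[OF B B c] projection_adjoint[OF k] by simp
    finally show "complex_of_real ((frobenius_norm (P k * B))\<^sup>2) = frobenius_inner n (P k * B) B" .
  qed
  also have "\<dots> = frobenius_inner n (msum n m (\<lambda>k. P k * B)) B"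
    by (rule frobenius_inner_msum_left[symmetric])
  also have "msum n m (\<lambda>k. P k * B) = B"
    using mult_msum_right[OF B, of m P] projection_carrier projection_sum B by simp
  finally show ?thesis
    unfolding frobenius_inner_self[OF B] of_real_eq_iff .
qed

lemma frobenius_norm_projection_le:
  assumes B: "B \<in> carrier_mat n n" and k: "k < m"
  shows "frobenius_norm (P k * B) \<le> frobenius_norm B"
proof (rule power2_le_imp_le)
  show "(frobenius_norm (P k * B))\<^sup>2 \<le> (frobenius_norm B)\<^sup>2"
    unfolding frobenius_norm_projection_sum[OF B, symmetric]
    by (rule member_le_sum) (use k in auto)
qed simp

text \<open>By Pythagoras it suffices to compare blocks, and the \<open>k\<close>-th block of \<open>\<Phi>(E)B\<close> is \<open>P\<^sub>kE(P\<^sub>kB)\<close>, of norm at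
  most \<open>c\<parallel>P\<^sub>kB\<parallel>\<close>.\<close>

lemma op_bound_pinching:
  assumes E: "op_bound n c E"
  shows "op_bound n c (pinching n m P E)"
  unfolding op_bound_def
proof (intro conjI ballI)
  note Ec = op_boundD(1)[OF E] and c0 = op_boundD(2)[OF E]
  show "pinching n m P E \<in> carrier_mat n n" "0 \<le> c" using c0 by auto
  fix B :: "complex mat" assume B: "B \<in> carrier_mat n n"
  have PB: "pinching n m P E * B \<in> carrier_mat n n" by (rule mult_square[OF pinching_carrier B])
  have "(frobenius_norm (pinching n m P E * B))\<^sup>2 =
      (\<Sum>k<m. (frobenius_norm (P k * (pinching n m P E * B)))\<^sup>2)"
    using frobenius_norm_projection_sum[OF PB] by simp
  also have "\<dots> \<le> (\<Sum>k<m. (c * frobenius_norm (P k * B))\<^sup>2)"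
  proof (intro sum_mono power_mono frobenius_norm_nonneg)
    fix k assume "k \<in> {..<m}"
    then have k: "k < m" by simp
    note Pc = projection_carrier[OF k]
    have PkB: "P k * B \<in> carrier_mat n n" using Pc B by simp
    have "P k * (pinching n m P E * B) = P k * pinching n m P E * B"
      using assoc_mult_mat[OF Pc pinching_carrier B] by simp
    also have "\<dots> = P k * (E * (P k * B))"
      unfolding projection_mult_pinching[OF Ec k]
      using Pc Ec B by (simp add: assoc_square[of _ n] mult_square[of _ n])
    finally have "frobenius_norm (P k * (pinching n m P E * B)) \<le> frobenius_norm (E * (P k * B))"
      using frobenius_norm_projection_le[OF mult_square[OF Ec PkB] k] by simp
    also have "\<dots> \<le> c * frobenius_norm (P k * B)" by (rule op_boundD(3)[OF E PkB])
    finally show "frobenius_norm (P k * (pinching n m P E * B)) \<le> c * frobenius_norm (P k * B)" .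
  qed
  also have "\<dots> = (c * frobenius_norm B)\<^sup>2"
    unfolding power_mult_distrib sum_distrib_left[symmetric] frobenius_norm_projection_sum[OF B] ..
  finally show "frobenius_norm (pinching n m P E * B) \<le> c * frobenius_norm B"
    by (rule power2_le_imp_le) (use c0 in simp)
qed

text \<open>A pinching is self-adjoint and idempotent, hence an orthogonal projection, for the Frobenius inner
  product.\<close>

lemma frobenius_norm_pinching_le:
  assumes K: "K \<in> carrier_mat n n"
  shows "frobenius_norm (pinching n m P K) \<le> frobenius_norm K"
proof -
  let ?x = "frobenius_norm (pinching n m P K)"
  have "complex_of_real (?x\<^sup>2) = frobenius_inner n K (pinching n m P K)"
    using frobenius_inner_self[OF pinching_carrier, of n m P K]
      frobenius_inner_pinching[OF P K pinching_carrier] pinching_idem[OF P K] by simp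
  then have "?x\<^sup>2 = cmod (frobenius_inner n K (pinching n m P K))"
    by (metis norm_of_real abs_of_nonneg zero_le_power2)
  also have "\<dots> \<le> frobenius_norm K * ?x"
    by (rule frobenius_inner_cauchy_schwarz[OF K pinching_carrier])
  finally have "?x * ?x \<le> frobenius_norm K * ?x" by (simp add: power2_eq_square)
  then show ?thesis
    using frobenius_norm_nonneg[of "pinching n m P K"] frobenius_norm_nonneg[of K]
    by (cases "?x = 0") (auto intro: mult_right_le_imp_le)
qed

end

lemma cluster_null_pinching:
  assumes P: "\<And>n. projection_resolution n (m n) (P n)" and X: "cluster_null X"
  shows "cluster_null (\<lambda>n. pinching n (m n) (P n) (X n))"
  unfolding cluster_null_def
proof (intro allI impI)
  fix \<epsilon> :: real assume e: "\<epsilon> > 0"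
  obtain C N where C: "\<And>n. n > N \<Longrightarrow> \<exists>K E. X n = K + E \<and>
     K \<in> carrier_mat n n \<and> frobenius_norm K \<le> C \<and> op_bound n \<epsilon> E"
    using cluster_nullE[OF X e] by metis
  show "\<exists>C N. \<forall>n>N. \<exists>K E. pinching n (m n) (P n) (X n) = K + E \<and>
     K \<in> carrier_mat n n \<and> frobenius_norm K \<le> C \<and> op_bound n \<epsilon> E"
  proof (rule exI[of _ C], rule exI[of _ N], intro allI impI)
    fix n assume "n > N"
    then obtain K E where *: "X n = K + E" "K \<in> carrier_mat n n"
       "frobenius_norm K \<le> C" "op_bound n \<epsilon> E"
      using C[of n] by auto
    have "pinching n (m n) (P n) (X n) = pinching n (m n) (P n) K + pinching n (m n) (P n) E"
      unfolding *(1) by (rule pinching_add[OF P *(2) op_boundD(1)[OF *(4)]])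
    then show "\<exists>K E. pinching n (m n) (P n) (X n) = K + E \<and>
     K \<in> carrier_mat n n \<and> frobenius_norm K \<le> C \<and> op_bound n \<epsilon> E"
      using op_bound_pinching[OF P *(4)] order_trans[OF frobenius_norm_pinching_le[OF P *(2)] *(3)]
        pinching_carrier by blast
  qed
qed

lemma projection_resolution_conjugate:
  assumes P: "projection_resolution n m P" and U: "unitary_mat n U"
  shows "projection_resolution n m (\<lambda>k. U * P k * mat_adjoint U)"
proof -
  have Uc: "U \<in> carrier_mat n n" and VU: "mat_adjoint U * U = 1\<^sub>m n" and UV: "U * mat_adjoint U = 1\<^sub>m n"
    using U by (auto simp: unitary_mat_def)
  note c = projection_carrier[OF P] mat_adjoint_carrier[OF Uc] Uc
  have prod: "U * P k * mat_adjoint U * (U * P l * mat_adjoint U) = U * (P k * P l) * mat_adjoint U"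
    if "k < m" "l < m" for k l
  proof -
    have "U * P k * mat_adjoint U * (U * P l * mat_adjoint U) =
        U * P k * (mat_adjoint U * U) * P l * mat_adjoint U"
      using c(1)[OF that(1)] c(1)[OF that(2)] c(2,3)
      by (simp add: assoc_square[of _ n] mult_square[of _ n])
    then show ?thesis
      using c(1)[OF that(1)] c(1)[OF that(2)] c(2,3)
      by (simp add: VU assoc_square[of _ n] mult_square[of _ n])
  qed
  show ?thesis
    unfolding projection_resolution_def
  proof (intro conjI allI impI)
    fix k assume k: "k < m"
    show "U * P k * mat_adjoint U \<in> carrier_mat n n" using c(1)[OF k] c(2,3) by (simp add: mult_square[of _ n])
    show "mat_adjoint (U * P k * mat_adjoint U) = U * P k * mat_adjoint U"
      using c(1)[OF k] c(2,3) projection_adjoint[OF P k]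
      by (simp add: mat_adjoint_mult[where n = n] assoc_square[of _ n] mult_square[of _ n])
    show "U * P k * mat_adjoint U * (U * P k * mat_adjoint U) = U * P k * mat_adjoint U"
      by (simp add: prod k projection_idem[OF P])
  next
    fix k l assume kl: "k < m" "l < m" "k \<noteq> l"
    show "U * P k * mat_adjoint U * (U * P l * mat_adjoint U) = 0\<^sub>m n n"
      using c(2,3) by (simp add: prod kl projection_orthogonal[OF P])
  next
    have "msum n m (\<lambda>k. U * P k * mat_adjoint U) = msum n m (\<lambda>k. U * P k) * mat_adjoint U"
      by (rule mult_msum_right[symmetric, OF c(2)]) (use c in \<open>simp add: mult_square[of _ n]\<close>)
    also have "msum n m (\<lambda>k. U * P k) = U * msum n m P"
      by (rule mult_msum_left[symmetric, OF c(3) c(1)])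
    finally show "msum n m (\<lambda>k. U * P k * mat_adjoint U) = 1\<^sub>m n"
      using c(3) UV by (simp add: projection_sum[OF P])
  qed
qed

text \<open>Conjugating the resolution by \<open>U\<close> absorbs the unitary, so every statement about preconditioners is one
  about plain pinchings.\<close>

lemma frobenius_precond_eq_pinching:
  assumes P: "projection_resolution n m P" and U: "unitary_mat n U" and X: "X \<in> carrier_mat n n"
  shows "frobenius_precond n m P U X = pinching n m (\<lambda>k. U * P k * mat_adjoint U) X"
proof -
  have Uc: "U \<in> carrier_mat n n" using U by (simp add: unitary_mat_def)
  note c = projection_carrier[OF P] mat_adjoint_carrier[OF Uc] Uc
  have "U * pinching n m P (mat_adjoint U * X * U) * mat_adjoint U =
      msum n m (\<lambda>k. U * (P k * (mat_adjoint U * X * U) * P k)) * mat_adjoint U"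
    unfolding pinching_def
    by (subst mult_msum_left[OF c(3)]) (use c X in \<open>simp_all add: mult_square[of _ n]\<close>)
  also have "\<dots> = msum n m (\<lambda>k. U * (P k * (mat_adjoint U * X * U) * P k) * mat_adjoint U)"
    by (subst mult_msum_right[OF c(2)]) (use c X in \<open>simp_all add: mult_square[of _ n]\<close>)
  also have "\<dots> = pinching n m (\<lambda>k. U * P k * mat_adjoint U) X"
    unfolding pinching_def msum_def
    by (intro cong_mat refl)
      (use c X in \<open>auto simp: assoc_square[of _ n] mult_square[of _ n] intro!: sum.cong\<close>)
  finally show ?thesis using frobenius_precond_eq(1)[OF P U X] by simp
qed

section \<open>Diagonalization of Hermitian matrices\<close>

lemma unitary_of_corthogonal:
  assumes ws: "set ws \<subseteq> carrier_vec n" "corthogonal ws" "length ws = n"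
    and unit: "\<And>w. w \<in> set ws \<Longrightarrow> w \<bullet>c w = (1::complex)"
  shows "unitary_mat n (mat_of_cols n ws)"
proof -
  let ?W = "mat_of_cols n ws"
  have W: "?W \<in> carrier_mat n n" using ws by auto
  have "mat_adjoint ?W * ?W = 1\<^sub>m n"
  proof (rule eq_matI)
    fix i j assume "i < dim_row (1\<^sub>m n :: complex mat)" "j < dim_col (1\<^sub>m n :: complex mat)"
    then have ij: "i < n" "j < n" by auto
    have w: "ws ! i \<in> carrier_vec n" "ws ! j \<in> carrier_vec n" using ws ij by auto
    have "(mat_adjoint ?W * ?W) $$ (i, j) = (\<Sum>k<n. cnj (ws ! i $ k) * ws ! j $ k)"
      unfolding mult_mat_index_sum[OF mat_adjoint_carrier[OF W] W ij]
      by (intro sum.cong refl) (use ij ws(3) in \<open>simp add: mat_adjoint_index[OF W] mat_of_cols_index\<close>)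
    also have "\<dots> = ws ! j \<bullet>c ws ! i"
      using w by (simp add: scalar_prod_def lessThan_atLeast0 mult.commute)
    also have "\<dots> = (if i = j then 1 else 0)"
      using unit[of "ws ! i"] corthogonalD[OF ws(2), of j i] ij ws(3) by auto
    finally show "(mat_adjoint ?W * ?W) $$ (i, j) = 1\<^sub>m n $$ (i, j)" using ij by simp
  qed (use W in auto)
  then show ?thesis
    using W mat_mult_left_right_inverse[OF mat_adjoint_carrier[OF W] W] by (simp add: unitary_mat_def)
qed

text \<open>Complete the vector to a basis, apply Gram-Schmidt, which keeps the first vector, and normalise.\<close>

lemma unitary_with_first_column:
  fixes v :: "complex vec"
  assumes v: "v \<in> carrier_vec n" and v0: "v \<noteq> 0\<^sub>v n"
  obtains W c where "unitary_mat n W" "col W 0 = c \<cdot>\<^sub>v v"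
proof -
  interpret cof_vec_space n "TYPE(complex)" .
  define b where "b = basis_completion v"
  define ws where "ws = gram_schmidt n b"
  note bc = basis_completion[OF v v0, folded b_def]
  have n: "n \<noteq> 0" using v v0 by (auto simp: vec_eq_iff)
  have hdb: "hd b = v" by (simp add: b_def basis_completion_def Let_def)
  then obtain vs where bv: "b = v # vs" using bc(6) n by (cases b) auto
  have ws: "set ws \<subseteq> carrier_vec n" "corthogonal ws" "length ws = n"
    using gram_schmidt_result[OF bc(2,4,5) ws_def] bc(6) by auto
  have hdws: "hd ws = v" using gram_schmidt_hd[OF v, of vs, folded bv] by (simp add: ws_def)
  define f :: "complex vec \<Rightarrow> complex vec" where "f w = (1 / sqrt (Re (w \<bullet>c w))) \<cdot>\<^sub>v w" for w
  have len: "length (map f ws) = n" using ws(3) by simp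
  have dim: "dim_vec (ws ! i) = n" if "i < n" for i using ws(1,3) that by (metis carrier_vecD nth_mem subsetD)
  have pos: "Re (ws ! i \<bullet>c ws ! i) > 0 \<and> Im (ws ! i \<bullet>c ws ! i) = 0" if "i < n" for i
  proof -
    have "ws ! i \<bullet>c ws ! i \<noteq> 0" using corthogonalD[OF ws(2), of i i] ws(3) that by simp
    moreover have "ws ! i \<bullet>c ws ! i \<ge> 0" by (rule conjugate_square_ge_0_vec)
    ultimately show ?thesis by (auto simp: less_eq_complex_def complex_eq_iff)
  qed
  have prod: "f (ws ! i) \<bullet>c f (ws ! j) = complex_of_real (1 / sqrt (Re (ws ! i \<bullet>c ws ! i)) * (1 / sqrt (Re (ws ! j \<bullet>c ws ! j)))) * (ws ! i \<bullet>c ws ! j)"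
    if "i < n" "j < n" for i j
    using that dim[OF that(1)] dim[OF that(2)]
    by (simp add: f_def conjugate_smult_vec)
  have "unitary_mat n (mat_of_cols n (map f ws))"
  proof (rule unitary_of_corthogonal)
    show "set (map f ws) \<subseteq> carrier_vec n" using ws(1) by (auto simp: f_def)
    show "corthogonal (map f ws)"
    proof (rule corthogonalI)
      fix i j assume "i < length (map f ws)" "j < length (map f ws)"
      then have ij: "i < n" "j < n" using ws(3) by auto
      show "(map f ws ! i \<bullet>c map f ws ! j = 0) = (i \<noteq> j)"
        using prod[OF ij] corthogonalD[OF ws(2), of i j] pos[OF ij(1)] pos[OF ij(2)] ij ws(3) by simp
    qed
    show "length (map f ws) = n" by (rule len)
    fix w assume "w \<in> set (map f ws)"
    then obtain i where i: "i < n" "w = f (ws ! i)" using ws(3) by (auto simp: in_set_conv_nth)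
    let ?r = "Re (ws ! i \<bullet>c ws ! i)"
    have "ws ! i \<bullet>c ws ! i = complex_of_real ?r" using pos[OF i(1)] by (simp add: complex_eq_iff)
    then have "w \<bullet>c w = complex_of_real (1 / sqrt ?r * (1 / sqrt ?r)) * complex_of_real ?r"
      unfolding i(2) prod[OF i(1) i(1)] by (rule arg_cong)
    also have "\<dots> = complex_of_real (1 / sqrt ?r * (1 / sqrt ?r) * ?r)" by simp
    also have "1 / sqrt ?r * (1 / sqrt ?r) * ?r = 1" using pos[OF i(1)] by simp
    finally show "w \<bullet>c w = 1" by simp
  qed
  moreover have "col (mat_of_cols n (map f ws)) 0 = (1 / sqrt (Re (v \<bullet>c v))) \<cdot>\<^sub>v v"
  proof -
    have "ws ! 0 = v" using hdws ws(3) n by (metis hd_conv_nth length_0_conv)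
    then show ?thesis using ws(3) n v by (simp add: f_def)
  qed
  ultimately show ?thesis by (rule that)
qed

text \<open>The block diagonal matrix with blocks \<open>a\<close> (of size one) and \<open>B\<close>, given entrywise so that products and
  adjoints reduce to the corner and the lower right block.\<close>

definition bordered_mat :: "nat \<Rightarrow> complex \<Rightarrow> complex mat \<Rightarrow> complex mat" where
  "bordered_mat n a B = mat (Suc n) (Suc n)
     (\<lambda>(i, j). if i = 0 \<and> j = 0 then a else if i = 0 \<or> j = 0 then 0 else B $$ (i - 1, j - 1))"

lemma bordered_mat_carrier [simp]: "bordered_mat n a B \<in> carrier_mat (Suc n) (Suc n)"
  by (simp add: bordered_mat_def)

lemma bordered_mat_mult:
  assumes A: "A \<in> carrier_mat n n" and B: "B \<in> carrier_mat n n"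
  shows "bordered_mat n a A * bordered_mat n b B = bordered_mat n (a * b) (A * B)"
proof (rule eq_matI)
  fix i j assume "i < dim_row (bordered_mat n (a * b) (A * B))"
    "j < dim_col (bordered_mat n (a * b) (A * B))"
  then have ij: "i < Suc n" "j < Suc n" by (auto simp: bordered_mat_def)
  show "(bordered_mat n a A * bordered_mat n b B) $$ (i, j) = bordered_mat n (a * b) (A * B) $$ (i, j)"
    unfolding mult_mat_index_sum[OF bordered_mat_carrier bordered_mat_carrier ij] sum.lessThan_Suc_shift
    by (cases i; cases j) (use ij mult_mat_index_sum[OF A B] in \<open>auto simp: bordered_mat_def\<close>)
qed (simp_all add: bordered_mat_def)

lemma bordered_mat_adjoint:
  assumes A: "A \<in> carrier_mat n n"
  shows "mat_adjoint (bordered_mat n a A) = bordered_mat n (cnj a) (mat_adjoint A)"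
proof (rule eq_matI)
  fix i j assume "i < dim_row (bordered_mat n (cnj a) (mat_adjoint A))"
    "j < dim_col (bordered_mat n (cnj a) (mat_adjoint A))"
  then have ij: "i < Suc n" "j < Suc n" by (auto simp: bordered_mat_def)
  show "mat_adjoint (bordered_mat n a A) $$ (i, j) = bordered_mat n (cnj a) (mat_adjoint A) $$ (i, j)"
    unfolding mat_adjoint_index[OF bordered_mat_carrier ij]
    using ij by (auto simp: bordered_mat_def mat_adjoint_index[OF A])
qed (simp_all add: bordered_mat_def)

lemma diagonal_mat_bordered:
  assumes "B \<in> carrier_mat n n" "diagonal_mat B"
  shows "diagonal_mat (bordered_mat n a B)"
  using assms by (auto simp: diagonal_mat_def bordered_mat_def)

lemma bordered_mat_one: "bordered_mat n 1 (1\<^sub>m n) = 1\<^sub>m (Suc n)"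
  by (rule eq_matI) (auto simp: bordered_mat_def)

lemma unitary_mat_bordered:
  assumes "unitary_mat n V"
  shows "unitary_mat (Suc n) (bordered_mat n 1 V)"
  using assms bordered_mat_mult[of V n "mat_adjoint V" 1 1] bordered_mat_mult[of "mat_adjoint V" n V 1 1]
  by (auto simp: unitary_mat_def bordered_mat_adjoint bordered_mat_one)

lemma unitary_mat_mult:
  assumes V: "unitary_mat n V" and W: "unitary_mat n W"
  shows "unitary_mat n (V * W)"
proof -
  have c: "V \<in> carrier_mat n n" "W \<in> carrier_mat n n" "mat_adjoint V \<in> carrier_mat n n"
    "mat_adjoint W \<in> carrier_mat n n"
    using assms by (auto simp: unitary_mat_def)
  have "mat_adjoint (V * W) * (V * W) = mat_adjoint W * (mat_adjoint V * V) * W"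
    using c by (simp add: mat_adjoint_mult[OF c(1,2)] assoc_square[of _ n] mult_square[of _ n])
  moreover have "V * W * mat_adjoint (V * W) = V * (W * mat_adjoint W) * mat_adjoint V"
    using c by (simp add: mat_adjoint_mult[OF c(1,2)] assoc_square[of _ n] mult_square[of _ n])
  ultimately show ?thesis
    using assms c by (simp add: unitary_mat_def)
qed

lemma complex_eigenvector_exists:
  fixes H :: "complex mat"
  assumes H: "H \<in> carrier_mat n n" and n: "n \<noteq> 0"
  obtains e v where "v \<in> carrier_vec n" "v \<noteq> 0\<^sub>v n" "H *\<^sub>v v = e \<cdot>\<^sub>v v"
proof -
  have "degree (char_poly H) \<noteq> 0" using degree_monic_char_poly[OF H] n by simp
  then have "\<not> constant (poly (char_poly H))" by (simp add: constant_degree)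
  then obtain e where "poly (char_poly H) e = 0" using fundamental_theorem_of_algebra by blast
  then have "eigenvalue H e" by (simp add: eigenvalue_root_char_poly[OF H])
  then obtain v where "eigenvector H v e" by (auto simp: eigenvalue_def)
  then show ?thesis using that H by (auto simp: eigenvector_def)
qed

text \<open>Induction on the size. A unitary whose first column is an eigenvector brings the matrix into a form
  with first column \<open>(e, 0, \<dots>, 0)\<close>; being Hermitian it is then block diagonal, and the
  induction hypothesis applies to the lower right block.\<close>

theorem hermitian_diagonalization:
  assumes "H \<in> carrier_mat n n" and "mat_adjoint H = H"
  shows "\<exists>V. unitary_mat n V \<and> diagonal_mat (mat_adjoint V * H * V)"
  using assms
proof (induction n arbitrary: H)
  case 0
  have "unitary_mat 0 (1\<^sub>m 0)" by (auto simp: unitary_mat_def intro!: eq_matI)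
  moreover have "diagonal_mat (mat_adjoint (1\<^sub>m 0) * H * 1\<^sub>m 0)" using 0 by (auto simp: diagonal_mat_def)
  ultimately show ?case by blast
next
  case (Suc n)
  note H = Suc.prems(1)
  obtain e v where v: "v \<in> carrier_vec (Suc n)" "v \<noteq> 0\<^sub>v (Suc n)" and Hv: "H *\<^sub>v v = e \<cdot>\<^sub>v v"
    using complex_eigenvector_exists[OF H] by blast
  obtain W c where W: "unitary_mat (Suc n) W" and col: "col W 0 = c \<cdot>\<^sub>v v"
    using unitary_with_first_column[OF v] by blast
  have Wc: "W \<in> carrier_mat (Suc n) (Suc n)" "mat_adjoint W \<in> carrier_mat (Suc n) (Suc n)"
    and WW: "mat_adjoint W * W = 1\<^sub>m (Suc n)"
    using W by (auto simp: unitary_mat_def)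
  define A where "A = mat_adjoint W * H * W"
  have Ac: "A \<in> carrier_mat (Suc n) (Suc n)" using Wc H by (simp add: A_def mult_square[of _ "Suc n"])
  have Aherm: "mat_adjoint A = A"
    using Wc H Suc.prems(2)
    by (simp add: A_def mat_adjoint_mult[where n = "Suc n"] mult_square[of _ "Suc n"] assoc_square[of _ "Suc n"])
  have A0: "A $$ (i, 0) = (if i = 0 then e else 0)" if i: "i < Suc n" for i
  proof -
    have HW: "H *\<^sub>v col W 0 = e \<cdot>\<^sub>v col W 0"
      using Hv H v by (simp add: col mult_mat_vec smult_smult_assoc mult.commute)
    have colW: "col W 0 \<in> carrier_vec (Suc n)" using Wc(1) by (metis carrier_matD(1) col_dim)
    have "col A 0 = mat_adjoint W *\<^sub>v col (H * W) 0"
      unfolding A_def assoc_square[OF Wc(2) H Wc(1)]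
      by (rule col_mult2[OF Wc(2) mult_square[OF H Wc(1)]]) simp
    also have "col (H * W) 0 = H *\<^sub>v col W 0" by (rule col_mult2[OF H Wc(1)]) simp
    also have "mat_adjoint W *\<^sub>v (H *\<^sub>v col W 0) = e \<cdot>\<^sub>v (mat_adjoint W *\<^sub>v col W 0)"
      unfolding HW by (rule mult_mat_vec[OF Wc(2) colW])
    also have "mat_adjoint W *\<^sub>v col W 0 = col (1\<^sub>m (Suc n)) 0"
      unfolding WW[symmetric] by (rule col_mult2[symmetric, OF Wc(2,1)]) simp
    finally have "col A 0 $ i = (e \<cdot>\<^sub>v col (1\<^sub>m (Suc n)) 0) $ i" by simp
    then show ?thesis using i Ac by simp
  qed
  define B where "B = mat n n (\<lambda>(i, j). A $$ (Suc i, Suc j))"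
  have Bc: "B \<in> carrier_mat n n" by (simp add: B_def)
  have Aent: "A $$ (i, j) = cnj (A $$ (j, i))" if "i < Suc n" "j < Suc n" for i j
    using mat_adjoint_index[OF Ac that] Aherm by simp
  have A: "A = bordered_mat n e B"
  proof (rule eq_matI)
    fix i j assume "i < dim_row (bordered_mat n e B)" "j < dim_col (bordered_mat n e B)"
    then have ij: "i < Suc n" "j < Suc n" by (auto simp: bordered_mat_def)
    show "A $$ (i, j) = bordered_mat n e B $$ (i, j)"
    proof (cases "j = 0")
      case True
      then show ?thesis using A0[OF ij(1)] ij by (simp add: bordered_mat_def)
    next
      case False
      then show ?thesis using Aent[OF ij] A0[OF ij(2)] ij by (auto simp: bordered_mat_def B_def)
    qed
  qed (use Ac in \<open>auto simp: bordered_mat_def\<close>)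
  have "mat_adjoint B = B"
  proof (rule eq_matI)
    fix i j assume "i < dim_row B" "j < dim_col B"
    then have ij: "i < n" "j < n" using Bc by auto
    then show "mat_adjoint B $$ (i, j) = B $$ (i, j)"
      using mat_adjoint_index[OF Bc ij] Aent[of "Suc i" "Suc j"] by (simp add: B_def)
  qed (use Bc in auto)
  then obtain V where V: "unitary_mat n V" and D: "diagonal_mat (mat_adjoint V * B * V)"
    using Suc.IH[OF Bc] by blast
  have Vc: "V \<in> carrier_mat n n" "mat_adjoint V \<in> carrier_mat n n" using V by (auto simp: unitary_mat_def)
  let ?V = "bordered_mat n 1 V"
  have "mat_adjoint (W * ?V) * H * (W * ?V) = mat_adjoint ?V * A * ?V"
    using Wc H mat_adjoint_carrier[OF bordered_mat_carrier[of n 1 V]]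
    by (simp add: A_def mat_adjoint_mult[where n = "Suc n"] mult_square[of _ "Suc n"] assoc_square[of _ "Suc n"])
  also have "\<dots> = bordered_mat n e (mat_adjoint V * B * V)"
    using Vc Bc by (simp add: A bordered_mat_adjoint bordered_mat_mult mult_square[of _ n])
  finally have "mat_adjoint (W * ?V) * H * (W * ?V) = bordered_mat n e (mat_adjoint V * B * V)" .
  moreover have "diagonal_mat (bordered_mat n e (mat_adjoint V * B * V))"
    by (rule diagonal_mat_bordered[OF mult_square[OF mult_square[OF Vc(2) Bc] Vc(1)] D])
  ultimately show ?case
    using unitary_mat_mult[OF W unitary_mat_bordered[OF V]] by metis
qed

section \<open>Singular values and strong clusters\<close>

text \<open>If the columns of \<open>Y\<close> are orthogonal with norms \<open>\<bar>d i\<bar>\<close>, then multiplication by \<open>Y\<close> scales the \<open>i\<close>-th row of \<open>W\<close>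
  by \<open>\<bar>d i\<bar>\<close>, as far as Frobenius norms are concerned.\<close>

lemma frobenius_norm_mult_of_gram_diagonal:
  assumes Y: "Y \<in> carrier_mat n n"
    and YY: "mat_adjoint Y * Y = mat n n (\<lambda>(i, j). if i = j then of_real ((d i)\<^sup>2) else 0)"
    and W: "W \<in> carrier_mat n n"
  shows "(frobenius_norm (Y * W))\<^sup>2 = (\<Sum>i<n. \<Sum>j<n. (d i)\<^sup>2 * (cmod (W $$ (i, j)))\<^sup>2)"
proof -
  let ?D = "mat n n (\<lambda>(i, j). if i = j then complex_of_real ((d i)\<^sup>2) else 0)"
  have YW: "Y * W \<in> carrier_mat n n" using Y W by simp
  have "mat_adjoint Y * (Y * W) = ?D * W"
    using assoc_mult_mat[OF mat_adjoint_carrier[OF Y] Y W] YY by simp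
  then have "complex_of_real ((frobenius_norm (Y * W))\<^sup>2) = frobenius_inner n W (?D * W)"
    using frobenius_inner_self[OF YW] frobenius_inner_mult_left[OF W YW Y] by simp
  also have "\<dots> = (\<Sum>i<n. \<Sum>j<n. cnj (W $$ (i, j)) * (of_real ((d i)\<^sup>2) * W $$ (i, j)))"
    unfolding frobenius_inner_def
  proof (intro sum.cong refl arg_cong2[where f = "(*)"])
    fix i j assume "i \<in> {..<n}" "j \<in> {..<n}"
    then have ij: "i < n" "j < n" by auto
    show "(?D * W) $$ (i, j) = of_real ((d i)\<^sup>2) * W $$ (i, j)"
    proof -
      have "(?D * W) $$ (i, j) = (\<Sum>k<n. if k = i then of_real ((d i)\<^sup>2) * W $$ (i, j) else 0)"
        unfolding mult_mat_index_sum[OF mat_carrier W ij] by (rule sum.cong) (use ij in auto)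
      then show ?thesis using ij by simp
    qed
  qed
  also have "\<dots> = complex_of_real (\<Sum>i<n. \<Sum>j<n. (d i)\<^sup>2 * (cmod (W $$ (i, j)))\<^sup>2)"
    by (simp add: complex_norm_square mult_ac del: of_real_power)
  finally show ?thesis unfolding of_real_eq_iff .
qed

text \<open>The columns of \<open>V\<close> are eigenvectors of \<open>X\<^sup>*X\<close>, so the columns of \<open>XV\<close> are orthogonal, and their norms are
  the singular values.\<close>

lemma unitary_right_singular_vectors:
  assumes X: "X \<in> carrier_mat n n"
  obtains V d where "unitary_mat n V" "\<And>i. 0 \<le> d i"
    "mat_adjoint (X * V) * (X * V) = mat n n (\<lambda>(i, j). if i = j then of_real ((d i)\<^sup>2) else 0)"
    "singular_values X = image_mset d (mset_set {..<n})"
proof -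
  let ?H = "mat_adjoint X * X"
  have H: "?H \<in> carrier_mat n n" by (rule mult_square[OF mat_adjoint_carrier[OF X] X])
  have "mat_adjoint ?H = ?H" by (simp add: mat_adjoint_mult[OF mat_adjoint_carrier[OF X] X])
  then obtain V where V: "unitary_mat n V" and D: "diagonal_mat (mat_adjoint V * ?H * V)"
    using hermitian_diagonalization[OF H] by blast
  have Vc: "V \<in> carrier_mat n n" "mat_adjoint V \<in> carrier_mat n n"
    and VV: "mat_adjoint V * V = 1\<^sub>m n" "V * mat_adjoint V = 1\<^sub>m n"
    using V by (auto simp: unitary_mat_def)
  let ?D = "mat_adjoint V * ?H * V"
  have Dc: "?D \<in> carrier_mat n n" by (rule mult_square[OF mult_square[OF Vc(2) H] Vc(1)])
  have XV: "X * V \<in> carrier_mat n n" using X Vc by simp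
  have D_gram: "?D = mat_adjoint (X * V) * (X * V)"
    unfolding mat_adjoint_mult[OF X Vc(1)] assoc_square[OF Vc(2) H Vc(1)]
      assoc_square[OF mat_adjoint_carrier[OF X] X Vc(1)]
    by (rule assoc_square[symmetric, OF Vc(2) mat_adjoint_carrier[OF X] XV])
  define d where "d i = sqrt (\<Sum>k<n. (cmod ((X * V) $$ (k, i)))\<^sup>2)" for i
  have diag: "?D $$ (i, i) = of_real ((d i)\<^sup>2)" if i: "i < n" for i
  proof -
    have "?D $$ (i, i) = (\<Sum>k<n. cnj ((X * V) $$ (k, i)) * (X * V) $$ (k, i))"
      unfolding D_gram mult_mat_index_sum[OF mat_adjoint_carrier[OF XV] XV i i]
      by (rule sum.cong[OF refl]) (simp only: mat_adjoint_index[OF XV i] lessThan_iff)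
    also have "\<dots> = of_real (\<Sum>k<n. (cmod ((X * V) $$ (k, i)))\<^sup>2)"
      unfolding of_real_sum complex_norm_square by (simp only: mult.commute)
    also have "(\<Sum>k<n. (cmod ((X * V) $$ (k, i)))\<^sup>2) = (d i)\<^sup>2"
      unfolding d_def by (rule real_sqrt_pow2[symmetric]) (rule sum_nonneg, simp)
    finally show ?thesis .
  qed
  have D_eq: "?D = mat n n (\<lambda>(i, j). if i = j then of_real ((d i)\<^sup>2) else 0)"
  proof (rule eq_matI)
    fix i j assume "i < dim_row (mat n n (\<lambda>(i, j). if i = j then complex_of_real ((d i)\<^sup>2) else 0))"
      "j < dim_col (mat n n (\<lambda>(i, j). if i = j then complex_of_real ((d i)\<^sup>2) else 0))"
    then have ij: "i < n" "j < n" by auto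
    show "?D $$ (i, j) = mat n n (\<lambda>(i, j). if i = j then of_real ((d i)\<^sup>2) else 0) $$ (i, j)"
    proof (cases "i = j")
      case True
      then show ?thesis using diag ij by simp
    next
      case False
      then have "?D $$ (i, j) = 0"
        by (rule D[unfolded diagonal_mat_def carrier_matD[OF Dc], rule_format, OF ij])
      then show ?thesis using False ij by simp
    qed
  qed (use carrier_matD[OF Dc] in simp_all)
  have "similar_mat_wit ?D ?H (mat_adjoint V) V"
    by (rule similar_mat_witI[OF VV refl Dc H Vc(2,1)])
  then have "similar_mat ?D ?H" unfolding similar_mat_def by blast
  then have "char_poly ?H = char_poly ?D" by (rule char_poly_similar[symmetric])
  also have "char_poly ?D = (\<Prod>a\<leftarrow>diag_mat ?D. [:- a, 1:])"
  proof (rule char_poly_upper_triangular[OF Dc])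
    show "upper_triangular ?D"
      unfolding D_eq by (rule upper_triangularI) simp
  qed
  also have "diag_mat ?D = map (\<lambda>i. of_real ((d i)\<^sup>2)) [0..<n]"
    unfolding diag_mat_def carrier_matD(1)[OF Dc] by (rule map_cong[OF refl], rule diag) simp
  finally have cp: "char_poly ?H = (\<Prod>p\<leftarrow>map (\<lambda>i. [:- of_real ((d i)\<^sup>2), 1:]) [0..<n]. p)"
    by (simp add: comp_def)
  have "proots (char_poly ?H) = (\<Sum>i\<leftarrow>[0..<n]. {#of_real ((d i)\<^sup>2)#})"
    unfolding cp by (subst proots_prod_list) (auto simp: comp_def)
  also have "\<dots> = image_mset (\<lambda>i. of_real ((d i)\<^sup>2)) (mset_set {..<n})"
  proof -
    have "(\<Sum>i\<leftarrow>xs. {#f i#}) = image_mset f (mset xs)" for f :: "nat \<Rightarrow> complex" and xs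
      by (induction xs) auto
    then show ?thesis unfolding lessThan_atLeast0 mset_upt[symmetric] .
  qed
  finally have "singular_values X = image_mset (\<lambda>i. sqrt ((d i)\<^sup>2)) (mset_set {..<n})"
    by (simp add: singular_values_def image_mset.compositionality comp_def)
  moreover have d0: "0 \<le> d i" for i by (simp add: d_def sum_nonneg)
  ultimately have "singular_values X = image_mset d (mset_set {..<n})" by simp
  then show ?thesis by (rule that[OF V d0 trans[OF D_gram[symmetric] D_eq]])
qed

definition coordinate_projection :: "nat \<Rightarrow> nat set \<Rightarrow> complex mat" where
  "coordinate_projection n S = mat n n (\<lambda>(i, j). if i = j \<and> i \<in> S then 1 else 0)"

lemma coordinate_projection_carrier [simp]: "coordinate_projection n S \<in> carrier_mat n n"
  by (simp add: coordinate_projection_def)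

lemma coordinate_projection_mult_index:
  assumes B: "B \<in> carrier_mat n n" and ij: "i < n" "j < n"
  shows "(coordinate_projection n S * B) $$ (i, j) = (if i \<in> S then B $$ (i, j) else 0)"
proof -
  have "(coordinate_projection n S * B) $$ (i, j) = (\<Sum>k<n. if k = i then (if i \<in> S then B $$ (i, j) else 0) else 0)"
    unfolding mult_mat_index_sum[OF coordinate_projection_carrier B ij]
    by (rule sum.cong) (use ij in \<open>auto simp: coordinate_projection_def\<close>)
  then show ?thesis using ij by simp
qed

lemma mult_coordinate_projection_index:
  assumes B: "B \<in> carrier_mat n n" and ij: "i < n" "j < n"
  shows "(B * coordinate_projection n S) $$ (i, j) = (if j \<in> S then B $$ (i, j) else 0)"
proof -
  have "(B * coordinate_projection n S) $$ (i, j) = (\<Sum>k<n. if k = j then (if j \<in> S then B $$ (i, j) else 0) else 0)"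
    unfolding mult_mat_index_sum[OF B coordinate_projection_carrier ij]
    by (rule sum.cong) (use ij in \<open>auto simp: coordinate_projection_def\<close>)
  then show ?thesis using ij by simp
qed

lemma op_bound_coordinate_projection: "op_bound n 1 (coordinate_projection n S)"
  unfolding op_bound_def
proof (intro conjI ballI)
  fix B :: "complex mat" assume B: "B \<in> carrier_mat n n"
  have "(frobenius_norm (coordinate_projection n S * B))\<^sup>2 \<le> (frobenius_norm B)\<^sup>2"
    unfolding frobenius_norm_square[OF B]
      frobenius_norm_square[OF mult_square[OF coordinate_projection_carrier B]]
    by (intro sum_mono) (simp add: coordinate_projection_mult_index[OF B] del: index_mult_mat(1))
  then show "frobenius_norm (coordinate_projection n S * B) \<le> 1 * frobenius_norm B"
    using power2_le_imp_le[OF _ frobenius_norm_nonneg] by simp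
qed auto

lemma frobenius_norm_coordinate_projection:
  assumes "S \<subseteq> {..<n}"
  shows "frobenius_norm (coordinate_projection n S) = sqrt (card S)"
proof -
  have "(frobenius_norm (coordinate_projection n S))\<^sup>2 = (\<Sum>i<n. \<Sum>j<n. if j = i then (if i \<in> S then 1 else 0) else 0)"
    unfolding frobenius_norm_square[OF coordinate_projection_carrier]
    by (intro sum.cong refl) (auto simp: coordinate_projection_def)
  also have "\<dots> = (\<Sum>i<n. if i \<in> S then 1 else 0)" by simp
  also have "\<dots> = card S"
    using assms by (simp add: sum.If_cases Int_absorb1)
  finally show ?thesis by (metis frobenius_norm_nonneg real_sqrt_abs abs_of_nonneg)
qed

lemma coordinate_projection_complement:
  "coordinate_projection n S + coordinate_projection n (- S) = 1\<^sub>m n"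
  by (rule eq_matI) (auto simp: coordinate_projection_def)

lemma op_bound_unitary:
  assumes V: "unitary_mat n V"
  shows "op_bound n 1 V"
  unfolding op_bound_def
proof (intro conjI ballI)
  show Vc: "V \<in> carrier_mat n n" using V by (simp add: unitary_mat_def)
  fix B :: "complex mat" assume B: "B \<in> carrier_mat n n"
  have "(frobenius_norm (V * B))\<^sup>2 = (frobenius_norm B)\<^sup>2"
  proof -
    have "mat_adjoint V * V = mat n n (\<lambda>(i, j). if i = j then of_real (1\<^sup>2) else 0)"
      using V by (auto simp: unitary_mat_def one_mat_def)
    from frobenius_norm_mult_of_gram_diagonal[OF Vc this B]
    show ?thesis unfolding frobenius_norm_square[OF B] by simp
  qed
  then show "frobenius_norm (V * B) \<le> 1 * frobenius_norm B" by simp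
qed simp

lemma unitary_mat_adjoint: "unitary_mat n V \<Longrightarrow> unitary_mat n (mat_adjoint V)"
  by (auto simp: unitary_mat_def)

lemma size_large_singular_values:
  fixes n :: nat
  assumes "singular_values X = image_mset d (mset_set {..<n})" "\<And>i. 0 \<le> d i"
  shows "size {#s \<in># singular_values X. s \<notin> {0..<\<epsilon>}#} = card {i. i < n \<and> \<epsilon> \<le> d i}"
proof -
  have "{#s \<in># singular_values X. s \<notin> {0..<\<epsilon>}#} = image_mset d (mset_set {i\<in>{..<n}. d i \<notin> {0..<\<epsilon>}})"
    unfolding assms(1) filter_mset_image_mset
    by (rule arg_cong[OF filter_mset_mset_set]) simp
  moreover have "{i\<in>{..<n}. d i \<notin> {0..<\<epsilon>}} = {i. i < n \<and> \<epsilon> \<le> d i}"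
    using assms(2) by auto
  ultimately show ?thesis by simp
qed

text \<open>Let \<open>J\<close> select the right singular vectors with singular value at least \<open>\<epsilon>\<close>, say \<open>s\<close> of them. Then
  \<open>\<epsilon>\<surd>s \<le> \<parallel>(K + E)VJ\<parallel> \<le> C + (\<epsilon>/2)\<surd>s\<close> in the Frobenius norm, which bounds \<open>s\<close> by \<open>(2C/\<epsilon>)\<^sup>2\<close>.\<close>

lemma strong_clusterI:
  assumes null: "cluster_null (\<lambda>n. X n - Y n)"
  shows "strong_cluster X Y"
  unfolding strong_cluster_def
proof (intro allI impI)
  fix \<epsilon> :: real assume e: "\<epsilon> > 0"
  obtain C N where C0: "0 \<le> C" and C: "\<And>n. n > N \<Longrightarrow> \<exists>K E. X n - Y n = K + E \<and>
     K \<in> carrier_mat n n \<and> frobenius_norm K \<le> C \<and> op_bound n (\<epsilon> / 2) E"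
    using cluster_nullE[OF null, of "\<epsilon> / 2"] e by (metis half_gt_zero)
  show "\<exists>N1 N2. \<forall>n>N2. size {#s \<in># singular_values (X n - Y n). s \<notin> {0..<\<epsilon>}#} \<le> N1"
  proof (rule exI[of _ "nat \<lfloor>(2 * C / \<epsilon>)\<^sup>2\<rfloor>"], rule exI[of _ N], intro allI impI)
    fix n assume "n > N"
    then obtain K E where KE: "X n - Y n = K + E" "K \<in> carrier_mat n n" "frobenius_norm K \<le> C"
      and E: "op_bound n (\<epsilon> / 2) E"
      using C by blast
    note Ec = op_boundD(1)[OF E]
    let ?Z = "X n - Y n"
    have Z: "?Z \<in> carrier_mat n n" using KE Ec by simp
    obtain V d where V: "unitary_mat n V" and d0: "\<And>i. 0 \<le> d i"
      and gram: "mat_adjoint (?Z * V) * (?Z * V) = mat n n (\<lambda>(i, j). if i = j then of_real ((d i)\<^sup>2) else 0)"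
      and sv: "singular_values ?Z = image_mset d (mset_set {..<n})"
      using unitary_right_singular_vectors[OF Z] by blast
    have Vc: "V \<in> carrier_mat n n" using V by (simp add: unitary_mat_def)
    define S where "S = {i. i < n \<and> \<epsilon> \<le> d i}"
    let ?J = "coordinate_projection n S"
    note Jc = coordinate_projection_carrier[of n S]
    have J: "frobenius_norm ?J = sqrt (card S)"
      by (rule frobenius_norm_coordinate_projection) (auto simp: S_def)
    have VJ: "V * ?J \<in> carrier_mat n n" by (rule mult_square[OF Vc Jc])
    have "(\<epsilon> * sqrt (card S))\<^sup>2 = (\<Sum>i<n. \<Sum>j<n. \<epsilon>\<^sup>2 * (cmod (?J $$ (i, j)))\<^sup>2)"
      unfolding J[symmetric] power_mult_distrib frobenius_norm_square[OF Jc] by (simp add: sum_distrib_left)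
    also have "\<dots> \<le> (\<Sum>i<n. \<Sum>j<n. (d i)\<^sup>2 * (cmod (?J $$ (i, j)))\<^sup>2)"
      using e by (intro sum_mono) (auto simp: coordinate_projection_def S_def)
    also have "\<dots> = (frobenius_norm (?Z * V * ?J))\<^sup>2"
      by (rule frobenius_norm_mult_of_gram_diagonal[symmetric, OF mult_square[OF Z Vc] gram Jc])
    finally have "\<epsilon> * sqrt (card S) \<le> frobenius_norm (?Z * V * ?J)"
      by (rule power2_le_imp_le) simp
    also have "?Z * V * ?J = K * (V * ?J) + E * (V * ?J)"
      unfolding assoc_square[OF Z Vc Jc] unfolding KE(1) by (rule add_mult_distrib_mat[OF KE(2) Ec VJ])
    also have "frobenius_norm (K * (V * ?J) + E * (V * ?J)) \<le> frobenius_norm (K * (V * ?J)) + frobenius_norm (E * (V * ?J))"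
      by (rule frobenius_norm_triangle[OF mult_square[OF KE(2) VJ] mult_square[OF Ec VJ]])
    also have "frobenius_norm (K * (V * ?J)) \<le> C"
      using frobenius_norm_mult_op_bound[OF op_bound_mult[OF op_bound_unitary[OF V] op_bound_coordinate_projection] KE(2), of S] KE(3)
      by simp
    also have "frobenius_norm (E * (V * ?J)) \<le> \<epsilon> / 2 * sqrt (card S)"
    proof -
      have "frobenius_norm (V * ?J) \<le> sqrt (card S)"
        using op_boundD(3)[OF op_bound_unitary[OF V] Jc] J by simp
      then show ?thesis
        using op_boundD(3)[OF E VJ] e by (smt (verit) mult_left_mono half_gt_zero)
    qed
    finally have "sqrt (card S) \<le> 2 * C / \<epsilon>" using e by (simp add: field_simps)
    then have "real (card S) \<le> (2 * C / \<epsilon>)\<^sup>2"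
      by (metis of_nat_0_le_iff real_sqrt_ge_zero real_sqrt_pow2 power_mono)
    then have "card S \<le> nat \<lfloor>(2 * C / \<epsilon>)\<^sup>2\<rfloor>" by (rule le_nat_floor)
    then show "size {#s \<in># singular_values ?Z. s \<notin> {0..<\<epsilon>}#} \<le> nat \<lfloor>(2 * C / \<epsilon>)\<^sup>2\<rfloor>"
      unfolding size_large_singular_values[OF sv d0] S_def .
  qed
qed

text \<open>Cut the matrix along the span of the right singular vectors with large singular value. Few of them, of
  bounded size, give a bounded Frobenius norm; on the orthogonal complement the operator norm is at most
  \<open>\<epsilon>\<close>.\<close>

lemma strong_clusterD:
  assumes cluster: "strong_cluster X Y" and bounded: "op_bounded (\<lambda>n. X n - Y n)"
  shows "cluster_null (\<lambda>n. X n - Y n)"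
  unfolding cluster_null_def
proof (intro allI impI)
  fix \<epsilon> :: real assume e: "\<epsilon> > 0"
  obtain c where c: "\<And>n. op_bound n c (X n - Y n)" using bounded by (auto simp: op_bounded_def)
  obtain N1 N2 where N: "\<And>n. n > N2 \<Longrightarrow> size {#s \<in># singular_values (X n - Y n). s \<notin> {0..<\<epsilon>}#} \<le> N1"
    using cluster e unfolding strong_cluster_def by blast
  show "\<exists>C N. \<forall>n>N. \<exists>K E. X n - Y n = K + E \<and>
     K \<in> carrier_mat n n \<and> frobenius_norm K \<le> C \<and> op_bound n \<epsilon> E"
  proof (rule exI[of _ "c * sqrt N1"], rule exI[of _ N2], intro allI impI)
    fix n assume n: "n > N2"
    let ?Z = "X n - Y n"
    note Z = op_boundD(1)[OF c[of n]] and c0 = op_boundD(2)[OF c[of n]]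
    obtain V d where V: "unitary_mat n V" and d0: "\<And>i. 0 \<le> d i"
      and gram: "mat_adjoint (?Z * V) * (?Z * V) = mat n n (\<lambda>(i, j). if i = j then of_real ((d i)\<^sup>2) else 0)"
      and sv: "singular_values ?Z = image_mset d (mset_set {..<n})"
      using unitary_right_singular_vectors[OF Z] by blast
    have Vc: "V \<in> carrier_mat n n" "mat_adjoint V \<in> carrier_mat n n" and VV: "V * mat_adjoint V = 1\<^sub>m n"
      using V by (auto simp: unitary_mat_def)
    define S where "S = {i. i < n \<and> \<epsilon> \<le> d i}"
    have S: "card S \<le> N1" using N[OF n] unfolding size_large_singular_values[OF sv d0] S_def .
    let ?J = "\<lambda>S. coordinate_projection n S"
    have Jc: "?J T \<in> carrier_mat n n" for T by simp
    define Q where "Q T = V * ?J T * mat_adjoint V" for T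
    have Qc: "Q T \<in> carrier_mat n n" for T
      unfolding Q_def by (intro mult_square Vc Jc)
    have "Q S + Q (- S) = V * (?J S + ?J (- S)) * mat_adjoint V"
      unfolding Q_def mult_add_distrib_mat[OF Vc(1) Jc Jc]
      by (rule add_mult_distrib_mat[symmetric, OF mult_square[OF Vc(1) Jc] mult_square[OF Vc(1) Jc] Vc(2)])
    then have "Q S + Q (- S) = 1\<^sub>m n"
      using Vc VV by (simp add: coordinate_projection_complement)
    then have "?Z = ?Z * Q S + ?Z * Q (- S)"
      using mult_add_distrib_mat[OF Z Qc Qc] right_mult_one_mat[OF Z] by metis
    moreover have "?Z * Q S \<in> carrier_mat n n" by (rule mult_square[OF Z Qc])
    moreover have "frobenius_norm (?Z * Q S) \<le> c * sqrt N1"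
    proof (rule order_trans[OF op_boundD(3)[OF c Qc] mult_left_mono[OF _ c0]])
      have "frobenius_norm (Q S) \<le> frobenius_norm (V * ?J S)"
        using frobenius_norm_mult_op_bound[OF op_bound_unitary[OF unitary_mat_adjoint[OF V]] mult_square[OF Vc(1) Jc]]
        by (simp add: Q_def)
      also have "\<dots> \<le> frobenius_norm (?J S)"
        using op_boundD(3)[OF op_bound_unitary[OF V] Jc] by simp
      also have "\<dots> = sqrt (card S)"
        by (rule frobenius_norm_coordinate_projection) (auto simp: S_def)
      also have "\<dots> \<le> sqrt N1" using S by simp
      finally show "frobenius_norm (Q S) \<le> sqrt N1" .
    qed
    moreover have "op_bound n \<epsilon> (?Z * Q (- S))"
      unfolding op_bound_def
    proof (intro conjI ballI)
      show "?Z * Q (- S) \<in> carrier_mat n n" by (rule mult_square[OF Z Qc])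
      show "0 \<le> \<epsilon>" using e by simp
      fix B :: "complex mat" assume B: "B \<in> carrier_mat n n"
      let ?W = "mat_adjoint V * B"
      have W: "?W \<in> carrier_mat n n" by (rule mult_square[OF Vc(2) B])
      have eq: "?Z * Q (- S) * B = ?Z * V * (?J (- S) * ?W)"
        using Z Vc B by (simp add: Q_def assoc_square[of _ n] mult_square[of _ n])
      have "(frobenius_norm (?Z * Q (- S) * B))\<^sup>2 =
          (\<Sum>i<n. \<Sum>j<n. (d i)\<^sup>2 * (cmod ((?J (- S) * ?W) $$ (i, j)))\<^sup>2)"
        unfolding eq
        by (rule frobenius_norm_mult_of_gram_diagonal[OF mult_square[OF Z Vc(1)] gram mult_square[OF Jc W]])
      also have "\<dots> \<le> (\<Sum>i<n. \<Sum>j<n. \<epsilon>\<^sup>2 * (cmod (?W $$ (i, j)))\<^sup>2)"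
      proof (intro sum_mono)
        fix i j assume "i \<in> {..<n}" "j \<in> {..<n}"
        then have ij: "i < n" "j < n" by auto
        show "(d i)\<^sup>2 * (cmod ((?J (- S) * ?W) $$ (i, j)))\<^sup>2 \<le> \<epsilon>\<^sup>2 * (cmod (?W $$ (i, j)))\<^sup>2"
          unfolding coordinate_projection_mult_index[OF W ij]
          using d0[of i] ij by (auto simp: S_def intro!: mult_right_mono power_mono)
      qed
      also have "\<dots> = (\<epsilon> * frobenius_norm ?W)\<^sup>2"
        unfolding power_mult_distrib frobenius_norm_square[OF W] by (simp add: sum_distrib_left)
      finally have "frobenius_norm (?Z * Q (- S) * B) \<le> \<epsilon> * frobenius_norm ?W"
        by (rule power2_le_imp_le) (use e in simp)
      also have "\<dots> \<le> \<epsilon> * frobenius_norm B"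
        using op_boundD(3)[OF op_bound_unitary[OF unitary_mat_adjoint[OF V]] B] e by simp
      finally show "frobenius_norm (?Z * Q (- S) * B) \<le> \<epsilon> * frobenius_norm B" .
    qed
    ultimately show "\<exists>K E. ?Z = K + E \<and>
     K \<in> carrier_mat n n \<and> frobenius_norm K \<le> c * sqrt N1 \<and> op_bound n \<epsilon> E"
      by blast
  qed
qed

section \<open>Toeplitz matrices as compressions\<close>

text \<open>The additive bound is tested on \<open>C = TB/c\<close>, the choice that balances its two terms.\<close>

lemma op_bound_of_form_bound:
  assumes T: "T \<in> carrier_mat n n" and c: "0 < c"
    and form: "\<And>B C. B \<in> carrier_mat n n \<Longrightarrow> C \<in> carrier_mat n n \<Longrightarrow>
      cmod (frobenius_inner n C (T * B)) \<le> c / 2 * ((frobenius_norm C)\<^sup>2 + (frobenius_norm B)\<^sup>2)"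
  shows "op_bound n c T"
  unfolding op_bound_def
proof (intro conjI ballI)
  show "T \<in> carrier_mat n n" "0 \<le> c" using T c by auto
  fix B :: "complex mat" assume B: "B \<in> carrier_mat n n"
  let ?Z = "T * B" let ?z = "frobenius_norm ?Z"
  have Z: "?Z \<in> carrier_mat n n" by (rule mult_square[OF T B])
  define C where "C = of_real (1 / c) \<cdot>\<^sub>m ?Z"
  have C: "C \<in> carrier_mat n n" using Z by (simp add: C_def)
  have "frobenius_inner n C ?Z = of_real (1 / c) * frobenius_inner n ?Z ?Z"
    unfolding frobenius_inner_def sum_distrib_left
    by (intro sum.cong refl) (use carrier_matD[OF Z] in \<open>simp add: C_def del: index_mult_mat(1)\<close>)
  then have "cmod (frobenius_inner n C ?Z) = ?z\<^sup>2 / c"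
    using c by (simp add: frobenius_inner_self[OF Z] norm_mult norm_divide norm_power)
  moreover have "frobenius_norm C = ?z / c" using c by (simp add: C_def norm_divide)
  ultimately have "?z\<^sup>2 / c \<le> c / 2 * ((?z / c)\<^sup>2 + (frobenius_norm B)\<^sup>2)"
    using form[OF B C] by simp
  also have "\<dots> = ?z\<^sup>2 / c / 2 + c * (frobenius_norm B)\<^sup>2 / 2"
    using c by (simp add: power2_eq_square field_simps)
  finally have "?z\<^sup>2 / c \<le> c * (frobenius_norm B)\<^sup>2" by simp
  then have "?z\<^sup>2 \<le> (c * frobenius_norm B)\<^sup>2"
    using c by (simp add: power_mult_distrib power2_eq_square field_simps)
  then show "?z \<le> c * frobenius_norm B"
    by (rule power2_le_imp_le) (use c in simp)
qed

definition trig_sum :: "nat \<Rightarrow> (nat \<Rightarrow> complex) \<Rightarrow> real \<Rightarrow> complex" where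
  "trig_sum n u x = (\<Sum>l<n. u l * exp (\<i> * of_nat l * of_real x))"

lemma continuous_on_trig_sum [continuous_intros]: "continuous_on S (trig_sum n u)"
  unfolding trig_sum_def by (intro continuous_intros)

lemma fourier_kernel:
  "exp (- \<i> * of_int (int i - int l) * of_real x) =
    cnj (exp (\<i> * of_nat i * of_real x)) * exp (\<i> * of_nat l * of_real x)"
  by (simp add: exp_cnj algebra_simps flip: exp_add)

text \<open>A Toeplitz matrix is the compression of multiplication by its symbol to the trigonometric polynomials
  with frequencies \<open>0, \<dots>, n - 1\<close>.\<close>

lemma fourier_coeff_sesquilinear_form:
  assumes f: "continuous_on {0..2 * pi} f"
  shows "(\<Sum>i<n. \<Sum>l<n. cnj (v i) * (fourier_coeff f (int i - int l) * u l)) =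
    integral {0..2 * pi} (\<lambda>x. f x * (cnj (trig_sum n v x) * trig_sum n u x)) / (2 * of_real pi)"
proof -
  have int: "(\<lambda>x. cnj (v i) * (f x * exp (- \<i> * of_int (int i - int l) * of_real x)) * u l) integrable_on {0..2 * pi}" for i l
    by (intro integrable_continuous_interval continuous_intros f)
  have "f x * (cnj (trig_sum n v x) * trig_sum n u x) =
      (\<Sum>i<n. \<Sum>l<n. cnj (v i) * (f x * exp (- \<i> * of_int (int i - int l) * of_real x)) * u l)" for x
  proof -
    have "cnj (trig_sum n v x) * trig_sum n u x =
        (\<Sum>i<n. \<Sum>l<n. cnj (v i * exp (\<i> * of_nat i * of_real x)) * (u l * exp (\<i> * of_nat l * of_real x)))"
      unfolding trig_sum_def cnj_sum sum_product ..
    then show ?thesis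
      unfolding fourier_kernel by (simp only: sum_distrib_left complex_cnj_mult mult_ac)
  qed
  then have "integral {0..2 * pi} (\<lambda>x. f x * (cnj (trig_sum n v x) * trig_sum n u x)) =
      (\<Sum>i<n. \<Sum>l<n. integral {0..2 * pi} (\<lambda>x. cnj (v i) * (f x * exp (- \<i> * of_int (int i - int l) * of_real x)) * u l))"
    by (simp only: integral_sum[OF finite_lessThan] integrable_sum[OF finite_lessThan] int)
  also have "\<dots> = (\<Sum>i<n. \<Sum>l<n. cnj (v i) * (2 * of_real pi * fourier_coeff f (int i - int l)) * u l)"
    by (simp add: fourier_coeff_def)
  finally show ?thesis by (simp add: sum_divide_distrib mult_ac)
qed

lemma has_integral_exp_period:
  fixes k :: int
  shows "((\<lambda>x. exp (\<i> * of_int k * of_real x)) has_integral (if k = 0 then 2 * of_real pi else 0)) {0..2 * pi}"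
proof (cases "k = 0")
  case True
  then show ?thesis using has_integral_const_real[of "1::complex" 0 "2 * pi"]
    by (simp add: scaleR_conv_of_real)
next
  case False
  let ?F = "\<lambda>x. exp (\<i> * of_int k * of_real x) / (\<i> * of_int k)"
  have "((\<lambda>x. exp (\<i> * of_int k * of_real x)) has_integral (?F (2 * pi) - ?F 0)) {0..2 * pi}"
  proof (rule fundamental_theorem_of_calculus)
    fix x :: real assume "x \<in> {0..2 * pi}"
    have "((\<lambda>z. exp (\<i> * of_int k * z) / (\<i> * of_int k)) has_field_derivative exp (\<i> * of_int k * of_real x)) (at (of_real x))"
      by (rule derivative_eq_intros refl | use False in simp)+
    from has_vector_derivative_real_field[OF this]
    show "(?F has_vector_derivative exp (\<i> * of_int k * of_real x)) (at x within {0..2 * pi})"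
      by (simp add: has_vector_derivative_at_within)
  qed simp
  moreover have "exp (\<i> * of_int k * of_real (2 * pi)) = 1"
    using exp_integer_2pi[of "of_int k"] by (simp add: mult_ac)
  ultimately show ?thesis using False by simp
qed

lemma fourier_coeff_exp:
  "fourier_coeff (\<lambda>x. exp (\<i> * of_int m * of_real x)) k = (if k = m then 1 else 0)"
proof -
  have "(\<lambda>x. exp (\<i> * of_int m * of_real x) * exp (- \<i> * of_int k * of_real x)) =
      (\<lambda>x. exp (\<i> * of_int (m - k) * of_real x))"
    by (rule ext) (simp add: algebra_simps flip: exp_add)
  then show ?thesis
    using integral_unique[OF has_integral_exp_period[of "m - k"]] by (simp add: fourier_coeff_def)
qed

lemma fourier_coeff_mult_exp:
  "fourier_coeff (\<lambda>x. f x * exp (\<i> * of_int m * of_real x)) k = fourier_coeff f (k - m)"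
proof -
  have "f x * exp (\<i> * of_int m * of_real x) * exp (- \<i> * of_int k * of_real x) =
      f x * exp (- \<i> * of_int (k - m) * of_real x)" for x
    by (simp add: algebra_simps flip: exp_add)
  then show ?thesis by (simp only: fourier_coeff_def)
qed

text \<open>Parseval for finite sums, which is the form identity above for the constant symbol 1.\<close>

lemma integral_trig_sum_norm:
  "integral {0..2 * pi} (\<lambda>x. (cmod (trig_sum n u x))\<^sup>2) = 2 * pi * (\<Sum>l<n. (cmod (u l))\<^sup>2)"
proof -
  have "((\<lambda>x. (cmod (trig_sum n u x))\<^sup>2) has_integral
      integral {0..2 * pi} (\<lambda>x. (cmod (trig_sum n u x))\<^sup>2)) {0..2 * pi}"
    by (intro integrable_integral integrable_continuous_interval continuous_intros)
  from has_integral_linear[OF this bounded_linear_of_real[where 'a = complex]]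
  have "complex_of_real (integral {0..2 * pi} (\<lambda>x. (cmod (trig_sum n u x))\<^sup>2)) =
      integral {0..2 * pi} (\<lambda>x. 1 * (cnj (trig_sum n u x) * trig_sum n u x))"
    unfolding comp_def complex_norm_square
    by (intro integral_unique[symmetric]) (simp only: mult.commute mult_1_left mult_1_right)
  also have "\<dots> = 2 * of_real pi * (\<Sum>i<n. \<Sum>l<n. cnj (u i) * (fourier_coeff (\<lambda>x. 1) (int i - int l) * u l))"
    using fourier_coeff_sesquilinear_form[where f = "\<lambda>x. 1" and n = n and u = u and v = u] by simp
  also have "(\<lambda>k. fourier_coeff (\<lambda>x. 1) k) = (\<lambda>k. if k = 0 then 1 else 0)"
    using fourier_coeff_exp[of 0] by auto
  also have "(\<Sum>i<n. \<Sum>l<n. cnj (u i) * ((if int i - int l = 0 then 1 else 0) * u l)) =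
      (\<Sum>i<n. \<Sum>l<n. if l = i then cnj (u i) * u i else 0)"
    by (intro sum.cong refl) auto
  also have "\<dots> = of_real (\<Sum>l<n. (cmod (u l))\<^sup>2)"
    by (simp add: complex_norm_square mult.commute del: of_real_power)
  finally have "complex_of_real (integral {0..2 * pi} (\<lambda>x. (cmod (trig_sum n u x))\<^sup>2)) =
      of_real (2 * pi * (\<Sum>l<n. (cmod (u l))\<^sup>2))" by simp
  then show ?thesis unfolding of_real_eq_iff .
qed

lemma fourier_coeff_form_bound:
  assumes f: "continuous_on {0..2 * pi} f" and c: "\<And>x. x \<in> {0..2 * pi} \<Longrightarrow> cmod (f x) \<le> c"
  shows "cmod (\<Sum>i<n. \<Sum>l<n. cnj (v i) * (fourier_coeff f (int i - int l) * u l)) \<le>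
    c / 2 * ((\<Sum>i<n. (cmod (v i))\<^sup>2) + (\<Sum>l<n. (cmod (u l))\<^sup>2))"
proof -
  have c0: "0 \<le> c" using c[of 0] by (smt (verit) atLeastAtMost_iff norm_ge_zero pi_ge_zero)
  let ?g = "\<lambda>x. c / 2 * ((cmod (trig_sum n v x))\<^sup>2 + (cmod (trig_sum n u x))\<^sup>2)"
  have sq: "(\<lambda>x. (cmod (trig_sum n w x))\<^sup>2) integrable_on {0..2 * pi}" for w
    by (intro integrable_continuous_interval continuous_intros)
  have "cmod (integral {0..2 * pi} (\<lambda>x. f x * (cnj (trig_sum n v x) * trig_sum n u x))) \<le> integral {0..2 * pi} ?g"
  proof (rule integral_norm_bound_integral)
    show "(\<lambda>x. f x * (cnj (trig_sum n v x) * trig_sum n u x)) integrable_on {0..2 * pi}"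
      by (intro integrable_continuous_interval continuous_intros f)
    show "?g integrable_on {0..2 * pi}"
      by (intro integrable_continuous_interval continuous_intros)
    fix x assume x: "x \<in> {0..2 * pi}"
    have "cmod (f x * (cnj (trig_sum n v x) * trig_sum n u x)) \<le> c * (cmod (trig_sum n v x) * cmod (trig_sum n u x))"
      using c[OF x] by (simp add: norm_mult mult_right_mono)
    also have "cmod (trig_sum n v x) * cmod (trig_sum n u x) \<le> ((cmod (trig_sum n v x))\<^sup>2 + (cmod (trig_sum n u x))\<^sup>2) / 2"
      using sum_squares_bound[of "cmod (trig_sum n v x)" "cmod (trig_sum n u x)"] by simp
    finally show "cmod (f x * (cnj (trig_sum n v x) * trig_sum n u x)) \<le> ?g x"
      using c0 by (simp add: mult_left_mono)
  qed
  also have "integral {0..2 * pi} ?g = c / 2 * (2 * pi * ((\<Sum>i<n. (cmod (v i))\<^sup>2) + (\<Sum>l<n. (cmod (u l))\<^sup>2)))"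
    by (simp only: integral_mult_right integral_add[OF sq sq] integral_trig_sum_norm) (simp add: distrib_left)
  finally show ?thesis
    unfolding fourier_coeff_sesquilinear_form[OF f]
    by (simp add: norm_divide norm_mult field_simps)
qed

lemma toeplitz_carrier [simp]: "toeplitz n f \<in> carrier_mat n n"
  by (simp add: toeplitz_def)

lemma toeplitz_index:
  "i < n \<Longrightarrow> j < n \<Longrightarrow> toeplitz n f $$ (i, j) = fourier_coeff f (int i - int j)"
  by (simp add: toeplitz_def)

lemma op_bound_toeplitz:
  assumes f: "continuous_on {0..2 * pi} f" and c: "\<And>x. x \<in> {0..2 * pi} \<Longrightarrow> cmod (f x) \<le> c" and c0: "0 < c"
  shows "op_bound n c (toeplitz n f)"
proof (rule op_bound_of_form_bound[OF toeplitz_carrier c0])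
  fix B C :: "complex mat" assume B: "B \<in> carrier_mat n n" and C: "C \<in> carrier_mat n n"
  have "frobenius_inner n C (toeplitz n f * B) =
      (\<Sum>i<n. \<Sum>j<n. \<Sum>l<n. cnj (C $$ (i, j)) * (fourier_coeff f (int i - int l) * B $$ (l, j)))"
    unfolding frobenius_inner_def
    by (intro sum.cong refl)
      (simp add: mult_mat_index_sum[OF toeplitz_carrier B] sum_distrib_left toeplitz_index del: index_mult_mat(1))
  also have "\<dots> = (\<Sum>j<n. \<Sum>i<n. \<Sum>l<n. cnj (C $$ (i, j)) * (fourier_coeff f (int i - int l) * B $$ (l, j)))"
    by (rule sum.swap)
  also have "cmod \<dots> \<le> (\<Sum>j<n. c / 2 * ((\<Sum>i<n. (cmod (C $$ (i, j)))\<^sup>2) + (\<Sum>l<n. (cmod (B $$ (l, j)))\<^sup>2)))"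
    by (intro order_trans[OF norm_sum] sum_mono fourier_coeff_form_bound f c)
  also have "\<dots> = c / 2 * ((\<Sum>j<n. \<Sum>i<n. (cmod (C $$ (i, j)))\<^sup>2) + (\<Sum>j<n. \<Sum>l<n. (cmod (B $$ (l, j)))\<^sup>2))"
    unfolding sum_distrib_left[symmetric] sum.distrib ..
  also have "\<dots> = c / 2 * ((frobenius_norm C)\<^sup>2 + (frobenius_norm B)\<^sup>2)"
    unfolding frobenius_norm_square[OF B] frobenius_norm_square[OF C]
    by (simp only: sum.swap[of "\<lambda>i j. (cmod (_ $$ (i, j)))\<^sup>2"])
  finally show "cmod (frobenius_inner n C (toeplitz n f * B)) \<le> c / 2 * ((frobenius_norm C)\<^sup>2 + (frobenius_norm B)\<^sup>2)" .
qed

section \<open>Semicommutators of Toeplitz matrices\<close>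

lemma fourier_coeff_integrable:
  "continuous_on {0..2 * pi} f \<Longrightarrow> (\<lambda>x. f x * exp (- \<i> * of_int k * of_real x)) integrable_on {0..2 * pi}"
  by (intro integrable_continuous_interval continuous_intros)

lemma fourier_coeff_add:
  assumes "continuous_on {0..2 * pi} f" "continuous_on {0..2 * pi} g"
  shows "fourier_coeff (\<lambda>x. f x + g x) k = fourier_coeff f k + fourier_coeff g k"
  unfolding fourier_coeff_def distrib_right
    integral_add[OF fourier_coeff_integrable[OF assms(1)] fourier_coeff_integrable[OF assms(2)]]
  by (simp add: add_divide_distrib)

lemma fourier_coeff_cmult: "fourier_coeff (\<lambda>x. a * f x) k = a * fourier_coeff f k"
  by (simp add: fourier_coeff_def mult.assoc)

lemma fourier_coeff_cnj: "fourier_coeff (\<lambda>x. cnj (f x)) k = cnj (fourier_coeff f (- k))"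
  by (simp add: fourier_coeff_def integral_cnj exp_cnj)

lemma toeplitz_add:
  assumes "continuous_on {0..2 * pi} f" "continuous_on {0..2 * pi} g"
  shows "toeplitz n (\<lambda>x. f x + g x) = toeplitz n f + toeplitz n g"
  by (rule eq_matI) (auto simp: toeplitz_def fourier_coeff_add[OF assms])

lemma toeplitz_cmult: "toeplitz n (\<lambda>x. a * f x) = a \<cdot>\<^sub>m toeplitz n f"
  by (rule eq_matI) (auto simp: toeplitz_def fourier_coeff_cmult)

lemma toeplitz_diff:
  assumes f: "continuous_on {0..2 * pi} f" and g: "continuous_on {0..2 * pi} g"
  shows "toeplitz n (\<lambda>x. f x - g x) = toeplitz n f - toeplitz n g"
proof -
  have "toeplitz n (\<lambda>x. f x + - 1 * g x) = toeplitz n f + toeplitz n (\<lambda>x. - 1 * g x)"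
    by (rule toeplitz_add) (intro continuous_intros f g)+
  also have "\<dots> = toeplitz n f - toeplitz n g"
    unfolding toeplitz_cmult by (rule eq_matI) (auto simp: toeplitz_def)
  finally show ?thesis by simp
qed

lemma toeplitz_cnj: "toeplitz n (\<lambda>x. cnj (f x)) = mat_adjoint (toeplitz n f)"
  by (rule eq_matI)
    (simp_all add: toeplitz_index fourier_coeff_cnj mat_adjoint_index[OF toeplitz_carrier]
      carrier_matD[OF toeplitz_carrier])

lemma continuous_bounded_on_period:
  fixes f :: "real \<Rightarrow> complex"
  assumes f: "continuous_on {0..2 * pi} f"
  obtains c where "0 < c" "\<And>x. x \<in> {0..2 * pi} \<Longrightarrow> cmod (f x) \<le> c"
proof -
  have "bounded (f ` {0..2 * pi})" by (intro compact_imp_bounded compact_continuous_image f compact_Icc)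
  then obtain c where "0 < c" "\<forall>y\<in>f ` {0..2 * pi}. cmod y \<le> c" by (auto simp: bounded_pos)
  then show ?thesis using that by blast
qed

lemma op_bounded_toeplitz:
  assumes f: "continuous_on {0..2 * pi} f"
  shows "op_bounded (\<lambda>n. toeplitz n f)"
proof -
  obtain c where "0 < c" "\<And>x. x \<in> {0..2 * pi} \<Longrightarrow> cmod (f x) \<le> c"
    using continuous_bounded_on_period[OF f] by blast
  then show ?thesis using op_bound_toeplitz[OF f] unfolding op_bounded_def by blast
qed

text \<open>The failure of the map from symbols to Toeplitz matrices to be multiplicative.\<close>

definition semicommutator :: "(real \<Rightarrow> complex) \<Rightarrow> (real \<Rightarrow> complex) \<Rightarrow> nat \<Rightarrow> complex mat" where
  "semicommutator f g n = toeplitz n (\<lambda>x. f x * g x) - toeplitz n f * toeplitz n g"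

lemma semicommutator_carrier [simp]: "semicommutator f g n \<in> carrier_mat n n"
  unfolding semicommutator_def by (rule minus_carrier_mat[OF mult_square[OF toeplitz_carrier toeplitz_carrier]])

text \<open>The Toeplitz matrix of an exponential is a truncated shift. Multiplying by it moves columns, except
  that those shifted out of range are lost; they are what the semicommutator retains.\<close>

lemma semicommutator_exp:
  "semicommutator f (\<lambda>x. exp (\<i> * of_int m * of_real x)) n =
    toeplitz n (\<lambda>x. f x * exp (\<i> * of_int m * of_real x)) *
    coordinate_projection n {j. j < n \<and> int j + m \<notin> {0..<int n}}"
    (is "_ = ?T * coordinate_projection n ?S")
proof (rule eq_matI)
  let ?e = "\<lambda>x. exp (\<i> * of_int m * complex_of_real x)"
  fix i j assume "i < dim_row (?T * coordinate_projection n ?S)" "j < dim_col (?T * coordinate_projection n ?S)"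
  then have ij: "i < n" "j < n" by (auto simp: toeplitz_def coordinate_projection_def)
  have "(toeplitz n f * toeplitz n ?e) $$ (i, j) =
      (\<Sum>l<n. if int l = int j + m then fourier_coeff f (int i - int j - m) else 0)"
    unfolding mult_mat_index_sum[OF toeplitz_carrier toeplitz_carrier ij]
  proof (rule sum.cong[OF refl])
    fix l assume "l \<in> {..<n}"
    then have l: "l < n" by simp
    show "toeplitz n f $$ (i, l) * toeplitz n ?e $$ (l, j) =
        (if int l = int j + m then fourier_coeff f (int i - int j - m) else 0)"
      unfolding toeplitz_index[OF ij(1) l] toeplitz_index[OF l ij(2)] fourier_coeff_exp
      by (auto simp: diff_diff_eq)
  qed
  also have "\<dots> = (if int j + m \<in> {0..<int n} then fourier_coeff f (int i - int j - m) else 0)"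
  proof (cases "int j + m \<in> {0..<int n}")
    case True
    then have "int l = int j + m \<longleftrightarrow> l = nat (int j + m)" for l by auto
    then show ?thesis using True by (auto simp: nat_less_iff)
  qed auto
  finally have "semicommutator f ?e n $$ (i, j) = (if j \<in> ?S then ?T $$ (i, j) else 0)"
    using ij carrier_matD[OF mult_square[OF toeplitz_carrier[of n f] toeplitz_carrier[of n ?e]]]
    by (simp add: semicommutator_def toeplitz_index fourier_coeff_mult_exp del: index_mult_mat(1))
  then show "semicommutator f ?e n $$ (i, j) = (?T * coordinate_projection n ?S) $$ (i, j)"
    unfolding mult_coordinate_projection_index[OF toeplitz_carrier ij] .
qed (simp_all add: semicommutator_def toeplitz_def coordinate_projection_def)

text \<open>Only \<open>\<bar>m\<bar>\<close> columns are lost, whatever the size, and they form a product of a matrix of bounded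
  operator norm with a coordinate projection of rank at most \<open>\<bar>m\<bar>\<close>.\<close>

lemma cluster_null_semicommutator_exp:
  assumes f: "continuous_on {0..2 * pi} f"
  shows "cluster_null (semicommutator f (\<lambda>x. exp (\<i> * of_int m * of_real x)))"
proof -
  let ?e = "\<lambda>x. exp (\<i> * of_int m * complex_of_real x)"
  have fe: "continuous_on {0..2 * pi} (\<lambda>x. f x * ?e x)" by (intro continuous_intros f)
  obtain c where c: "0 < c" "\<And>x. x \<in> {0..2 * pi} \<Longrightarrow> cmod (f x * ?e x) \<le> c"
    using continuous_bounded_on_period[OF fe] by blast
  have K: "frobenius_norm (semicommutator f ?e n) \<le> c * sqrt (nat \<bar>m\<bar>)" for n
  proof -
    let ?S = "{j. j < n \<and> int j + m \<notin> {0..<int n}}"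
    \<comment> \<open>The lost columns are the first or the last \<open>\<bar>m\<bar>\<close> ones, according to the sign of \<open>m\<close>.\<close>
    have "inj_on (\<lambda>j. if m < 0 then j else n - 1 - j) ?S" by (auto simp: inj_on_def)
    moreover have "(\<lambda>j. if m < 0 then j else n - 1 - j) ` ?S \<subseteq> {..<nat \<bar>m\<bar>}" by auto
    ultimately have "card ?S \<le> nat \<bar>m\<bar>" using card_inj_on_le[of _ ?S "{..<nat \<bar>m\<bar>}"] by simp
    then have "sqrt (card ?S) \<le> sqrt (nat \<bar>m\<bar>)" by (intro real_sqrt_le_mono of_nat_mono)
    moreover have "frobenius_norm (semicommutator f ?e n) \<le> c * frobenius_norm (coordinate_projection n ?S)"
      unfolding semicommutator_exp
      by (rule op_boundD(3)[OF op_bound_toeplitz[OF fe c(2,1)] coordinate_projection_carrier])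
    moreover have "frobenius_norm (coordinate_projection n ?S) = sqrt (card ?S)"
      by (rule frobenius_norm_coordinate_projection) auto
    ultimately show ?thesis using c(1) by (smt (verit) mult_left_mono)
  qed
  show ?thesis by (rule cluster_null_of_frobenius_bound[OF semicommutator_carrier K])
qed

inductive_set trig_polys :: "(real \<Rightarrow> complex) set" where
  monomial: "(\<lambda>x. a * exp (\<i> * of_int m * of_real x)) \<in> trig_polys"
| add: "p \<in> trig_polys \<Longrightarrow> q \<in> trig_polys \<Longrightarrow> (\<lambda>x. p x + q x) \<in> trig_polys"

lemma continuous_on_trig_polys: "p \<in> trig_polys \<Longrightarrow> continuous_on S p"
  by (induction rule: trig_polys.induct) (intro continuous_intros; assumption)+

lemma semicommutator_add:
  assumes f: "continuous_on {0..2 * pi} f" and p: "continuous_on {0..2 * pi} p" and q: "continuous_on {0..2 * pi} q"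
  shows "semicommutator f (\<lambda>x. p x + q x) n = semicommutator f p n + semicommutator f q n"
proof -
  have "toeplitz n (\<lambda>x. f x * p x + f x * q x) = toeplitz n (\<lambda>x. f x * p x) + toeplitz n (\<lambda>x. f x * q x)"
    by (rule toeplitz_add) (intro continuous_intros f p q)+
  moreover have "toeplitz n f * toeplitz n (\<lambda>x. p x + q x) = toeplitz n f * toeplitz n p + toeplitz n f * toeplitz n q"
    unfolding toeplitz_add[OF p q] by (rule mult_add_distrib_mat[OF toeplitz_carrier[of n] toeplitz_carrier[of n] toeplitz_carrier[of n]])
  ultimately show ?thesis
    unfolding semicommutator_def distrib_left
    by (intro eq_matI) (simp_all add: toeplitz_def del: index_mult_mat(1))
qed

lemma semicommutator_cmult: "semicommutator f (\<lambda>x. a * p x) n = a \<cdot>\<^sub>m semicommutator f p n"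
proof -
  have "toeplitz n (\<lambda>x. f x * (a * p x)) = a \<cdot>\<^sub>m toeplitz n (\<lambda>x. f x * p x)"
    using toeplitz_cmult[of n a "\<lambda>x. f x * p x"] by (simp add: mult_ac)
  moreover have "toeplitz n f * toeplitz n (\<lambda>x. a * p x) = a \<cdot>\<^sub>m (toeplitz n f * toeplitz n p)"
    unfolding toeplitz_cmult by (rule mult_smult_distrib[OF toeplitz_carrier[of n] toeplitz_carrier[of n]])
  ultimately show ?thesis
    unfolding semicommutator_def
    by (intro eq_matI) (simp_all add: toeplitz_def right_diff_distrib del: index_mult_mat(1))
qed

lemma cluster_null_semicommutator_trig_poly:
  assumes f: "continuous_on {0..2 * pi} f" and p: "p \<in> trig_polys"
  shows "cluster_null (semicommutator f p)"
  using p
proof (induction rule: trig_polys.induct)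
  case (monomial a m)
  show ?case
    using cluster_null_smult[OF cluster_null_semicommutator_exp[OF f], of a m]
    by (simp only: semicommutator_cmult[abs_def])
next
  case (add p q)
  then show ?case
    using cluster_null_add[OF add.IH]
    by (simp only: semicommutator_add[OF f continuous_on_trig_polys[OF add.hyps(1)] continuous_on_trig_polys[OF add.hyps(2)], abs_def])
qed

section \<open>Density of trigonometric polynomials\<close>

lemma trig_polys_const: "(\<lambda>x. a) \<in> trig_polys"
  using trig_polys.monomial[of a 0] by simp

lemma trig_polys_mult:
  assumes "p \<in> trig_polys" "q \<in> trig_polys"
  shows "(\<lambda>x. p x * q x) \<in> trig_polys"
  using assms(1)
proof (induction rule: trig_polys.induct)
  case (monomial a m)
  show ?case using assms(2)
  proof (induction rule: trig_polys.induct)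
    case (monomial b k)
    have "(\<lambda>x. a * exp (\<i> * of_int m * of_real x) * (b * exp (\<i> * of_int k * of_real x))) =
        (\<lambda>x. (a * b) * exp (\<i> * of_int (m + k) * of_real x))"
      by (rule ext) (simp add: exp_add ring_distribs)
    then show ?case using trig_polys.monomial[of "a * b" "m + k"] by simp
  next
    case (add p q)
    show ?case unfolding distrib_left using add.IH by (rule trig_polys.add)
  qed
next
  case (add p q)
  show ?case unfolding distrib_right using add.IH by (rule trig_polys.add)
qed

lemma trig_polys_of_real_polynomial:
  assumes "real_polynomial_function p"
  shows "(\<lambda>x. of_real (p (cis x))) \<in> trig_polys"
  using assms
proof (induction rule: real_polynomial_function.induct)
  case (linear f)
  then interpret bounded_linear f .
  have f_cis: "f (cis x) = cos x * f 1 + sin x * f \<i>" for x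
    using add[of "cos x *\<^sub>R 1" "sin x *\<^sub>R \<i>"] scaleR[of "cos x" 1] scaleR[of "sin x" \<i>]
    by (simp add: cis_conv_exp exp_Euler cos_of_real sin_of_real scaleR_conv_of_real mult.commute)
  have euler: "complex_of_real (cos x) = (exp (\<i> * of_real x) + exp (- (\<i> * of_real x))) / 2"
    "complex_of_real (sin x) = - \<i> * (exp (\<i> * of_real x) - exp (- (\<i> * of_real x))) / 2" for x
    using cos_exp_eq[of "of_real x"] sin_exp_eq[of "of_real x"]
    by (simp_all add: cos_of_real sin_of_real)
  have eq: "complex_of_real (f (cis x)) =
      (f 1 - \<i> * f \<i>) / 2 * exp (\<i> * of_int 1 * of_real x) +
      (f 1 + \<i> * f \<i>) / 2 * exp (\<i> * of_int (- 1) * of_real x)" for x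
    unfolding f_cis of_real_add of_real_mult euler by (simp add: field_simps)
  show ?case unfolding eq by (intro trig_polys.add trig_polys.monomial)
next
  case (const c)
  show ?case by (rule trig_polys_const)
next
  case (add f g)
  then show ?case using trig_polys.add by simp
next
  case (mult f g)
  then show ?case using trig_polys_mult by simp
qed

lemma cont_periodic_shift:
  assumes f: "f \<in> cont_periodic"
  shows "f (x + 2 * pi * of_int k) = f x"
proof -
  have step: "f (x + 2 * pi) = f x" for x using f by (simp add: cont_periodic_def)
  have nat: "f (x + 2 * pi * of_nat k) = f x" for k x
  proof (induction k)
    case (Suc k)
    then show ?case using step[of "x + 2 * pi * of_nat k"] by (simp add: algebra_simps)
  qed simp
  show ?thesis
  proof (cases "k \<ge> 0")
    case True
    then show ?thesis using nat[of x "nat k"] by simp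
  next
    case False
    then show ?thesis using nat[of "x + 2 * pi * of_int k" "nat (- k)"] by simp
  qed
qed

lemma cont_periodic_eq_of_exp_eq:
  assumes f: "f \<in> cont_periodic" and "exp (\<i> * of_real x) = exp (\<i> * of_real y)"
  shows "f x = f y"
proof -
  obtain k :: int where "\<i> * of_real x = \<i> * of_real y + of_int (2 * k) * of_real pi * \<i>"
    using assms(2) by (auto simp: exp_eq)
  then have "x = y + 2 * pi * of_int k" by (simp add: complex_eq_iff mult_ac)
  then show ?thesis using cont_periodic_shift[OF f] by simp
qed

text \<open>A periodic function descends to a continuous function on the unit circle. There Stone-Weierstrass
  gives an approximating polynomial in the coordinates \<open>cos x\<close> and \<open>sin x\<close>, which are trigonometric
  polynomials.\<close>

lemma trig_polys_dense:
  assumes f: "f \<in> cont_periodic" and e: "0 < \<epsilon>"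
  obtains p where "p \<in> trig_polys" "\<And>x. cmod (f x - p x) < \<epsilon>"
proof -
  have fc: "isCont f x" for x
    using f by (simp add: cont_periodic_def continuous_on_eq_continuous_at)
  \<comment> \<open>The two branches of the argument are continuous off opposite half-lines, and periodicity makes\<close>
  \<comment> \<open>them interchangeable under \<open>f\<close>.\<close>
  have "f (Arg z) = f (Arg2pi z)" for z
  proof (cases "z = 0")
    case False
    have "of_real (cmod z) * exp (\<i> * of_real (Arg z)) = of_real (cmod z) * exp (\<i> * of_real (Arg2pi z))"
      using Arg_eq[OF False] Arg2pi_eq[of z] by metis
    then have "exp (\<i> * of_real (Arg z)) = exp (\<i> * of_real (Arg2pi z))" using False by simp
    then show ?thesis by (rule cont_periodic_eq_of_exp_eq[OF f])
  qed (simp add: Arg_zero)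
  then have F_eq: "(\<lambda>z. f (Arg z)) = (\<lambda>z. f (Arg2pi z))" by (rule ext)
  have "isCont (\<lambda>z. f (Arg z)) z" if z: "cmod z = 1" for z
  proof (cases "z \<in> \<real>\<^sub>\<le>\<^sub>0")
    case False
    then show ?thesis by (intro isCont_o2[OF continuous_at_Arg fc])
  next
    case True
    have "z \<noteq> 0" using z by auto
    with True have "z \<notin> \<real>\<^sub>\<ge>\<^sub>0"
      by (auto simp: complex_nonneg_Reals_iff complex_nonpos_Reals_iff complex_eq_iff)
    then show ?thesis unfolding F_eq by (intro isCont_o2[OF continuous_at_Arg2pi fc])
  qed
  then have cont: "continuous_on (sphere 0 1) (\<lambda>z. f (Arg z))"
    by (intro continuous_at_imp_continuous_on) auto
  obtain g where g: "polynomial_function g" "\<And>z. z \<in> sphere 0 1 \<Longrightarrow> cmod (f (Arg z) - g z) < \<epsilon>"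
    using Stone_Weierstrass_polynomial_function[OF compact_sphere cont e] by blast
  have "real_polynomial_function (\<lambda>z. Re (g z))" "real_polynomial_function (\<lambda>z. Im (g z))"
    using g(1) bounded_linear_Re bounded_linear_Im by (auto simp: polynomial_function_def comp_def)
  then have "(\<lambda>x. of_real (Re (g (cis x))) + \<i> * of_real (Im (g (cis x)))) \<in> trig_polys"
    by (intro trig_polys.add trig_polys_mult trig_polys_const trig_polys_of_real_polynomial)
  then have "(\<lambda>x. g (cis x)) \<in> trig_polys" by (simp flip: complex_eq)
  moreover have "cmod (f x - g (cis x)) < \<epsilon>" for x
  proof -
    have "exp (\<i> * of_real (Arg (cis x))) = exp (\<i> * of_real x)"
      using complex_norm_eq_1_exp[of "cis x"] Complex_Transcendental.Arg_eq[of "cis x"] by (simp add: cis_conv_exp)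
    then have "f (Arg (cis x)) = f x" by (rule cont_periodic_eq_of_exp_eq[OF f])
    then show ?thesis using g(2)[of "cis x"] by simp
  qed
  ultimately show ?thesis by (rule that)
qed

lemma op_bound_semicommutator:
  assumes f: "continuous_on {0..2 * pi} f" "\<And>x. x \<in> {0..2 * pi} \<Longrightarrow> cmod (f x) \<le> c" "0 < c"
    and h: "continuous_on {0..2 * pi} h" "\<And>x. x \<in> {0..2 * pi} \<Longrightarrow> cmod (h x) \<le> d" "0 < d"
  shows "op_bound n (2 * (c * d)) (semicommutator f h n)"
proof -
  have "op_bound n (c * d) (toeplitz n (\<lambda>x. f x * h x))"
    by (rule op_bound_toeplitz)
      (use assms in \<open>auto intro!: continuous_intros mult_mono simp: norm_mult\<close>)
  moreover have "op_bound n (c * d) (toeplitz n f * toeplitz n h)"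
    by (rule op_bound_mult[OF op_bound_toeplitz[OF f] op_bound_toeplitz[OF h]])
  ultimately have "op_bound n (c * d + c * d) (semicommutator f h n)"
    unfolding semicommutator_def by (rule op_bound_diff)
  then show ?thesis by simp
qed

text \<open>The semicommutator depends continuously on the second symbol, uniformly in the matrix size, so density of
  the trigonometric polynomials suffices.\<close>

lemma cluster_null_semicommutator:
  assumes f: "f \<in> cont_periodic" and g: "g \<in> cont_periodic"
  shows "cluster_null (semicommutator f g)"
proof (rule cluster_null_limit)
  have fc: "continuous_on {0..2 * pi} f" and gc: "continuous_on {0..2 * pi} g"
    using f g by (auto simp: cont_periodic_def intro: continuous_on_subset)
  obtain c where c: "0 < c" "\<And>x. x \<in> {0..2 * pi} \<Longrightarrow> cmod (f x) \<le> c"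
    using continuous_bounded_on_period[OF fc] by blast
  fix \<epsilon> :: real assume e: "\<epsilon> > 0"
  define d where "d = \<epsilon> / (2 * c)"
  have d: "0 < d" using e c by (simp add: d_def)
  obtain p where p: "p \<in> trig_polys" and gp: "\<And>x. cmod (g x - p x) < d"
    using trig_polys_dense[OF g d] by blast
  note pc = continuous_on_trig_polys[OF p]
  have "op_bound n \<epsilon> (semicommutator f g n - semicommutator f p n)" for n
  proof -
    have "semicommutator f g n = semicommutator f (\<lambda>x. (g x - p x) + p x) n" by simp
    also have "\<dots> = semicommutator f (\<lambda>x. g x - p x) n + semicommutator f p n"
      by (rule semicommutator_add) (intro continuous_intros fc gc pc)+
    finally have "semicommutator f g n - semicommutator f p n = semicommutator f (\<lambda>x. g x - p x) n"
      using carrier_matD[OF semicommutator_carrier[of f p n]]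
        carrier_matD[OF semicommutator_carrier[of f "\<lambda>x. g x - p x" n]]
      by (intro eq_matI) simp_all
    moreover have "op_bound n (2 * (c * d)) (semicommutator f (\<lambda>x. g x - p x) n)"
      by (rule op_bound_semicommutator)
        (use fc gc pc c d gp in \<open>auto intro!: continuous_intros less_imp_le\<close>)
    moreover have "2 * (c * d) = \<epsilon>" using c by (simp add: d_def)
    ultimately show ?thesis by simp
  qed
  then show "\<exists>Y. cluster_null Y \<and> (\<forall>n. Y n \<in> carrier_mat n n \<and> op_bound n \<epsilon> (semicommutator f g n - Y n))"
    using cluster_null_semicommutator_trig_poly[OF fc p] semicommutator_carrier by blast
qed simp

section \<open>The algebra of symbols compatible with a pinching\<close>

definition pinching_compatible :: "(nat \<Rightarrow> nat) \<Rightarrow> (nat \<Rightarrow> nat \<Rightarrow> complex mat) \<Rightarrow> (real \<Rightarrow> complex) set" where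
  "pinching_compatible m Q = {f \<in> cont_periodic.
     cluster_null (\<lambda>n. pinching n (m n) (Q n) (toeplitz n f) - toeplitz n f)}"

lemma cont_periodic_continuous_on: "f \<in> cont_periodic \<Longrightarrow> continuous_on S f"
  by (auto simp: cont_periodic_def intro: continuous_on_subset)

lemma op_bounded_pinching:
  assumes "\<And>n. projection_resolution n (m n) (Q n)" and "op_bounded X"
  shows "op_bounded (\<lambda>n. pinching n (m n) (Q n) (X n))"
  using assms op_bound_pinching unfolding op_bounded_def by blast

text \<open>Write \<open>\<Phi>\<close> for the pinching and \<open>T\<close> for Toeplitz matrices. The difference \<open>R = T(fg) - \<Phi>(T f)\<Phi>(T g)\<close> is
  clustered at zero, since modulo such sequences \<open>T(fg)\<close> is \<open>T f T g\<close> and \<open>T f\<close>, \<open>T g\<close> agree with their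
  pinchings. As \<open>\<Phi>\<close> fixes the product \<open>\<Phi>(T f)\<Phi>(T g)\<close>, the sequence in question is \<open>\<Phi>(R) - R\<close>.\<close>

lemma pinching_compatible_mult:
  assumes Q: "\<And>n. projection_resolution n (m n) (Q n)"
    and f: "f \<in> pinching_compatible m Q" and g: "g \<in> pinching_compatible m Q"
  shows "(\<lambda>x. f x * g x) \<in> pinching_compatible m Q"
proof -
  let ?\<Phi> = "\<lambda>n. pinching n (m n) (Q n)"
  let ?T = toeplitz
  have fg: "f \<in> cont_periodic" "g \<in> cont_periodic"
    and fn: "cluster_null (\<lambda>n. ?\<Phi> n (?T n f) - ?T n f)" and gn: "cluster_null (\<lambda>n. ?\<Phi> n (?T n g) - ?T n g)"
    using f g by (auto simp: pinching_compatible_def)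
  note bounded = op_bounded_toeplitz[OF cont_periodic_continuous_on[OF fg(1)]]
    op_bounded_toeplitz[OF cont_periodic_continuous_on[OF fg(2)]]
  define R where "R n = semicommutator f g n - (?\<Phi> n (?T n f) - ?T n f) * ?T n g
      - ?\<Phi> n (?T n f) * (?\<Phi> n (?T n g) - ?T n g)" for n
  have R_null: "cluster_null R"
    unfolding R_def
    by (intro cluster_null_diff cluster_null_mult_left cluster_null_mult_right fn gn
        op_bounded_pinching[OF Q] bounded cluster_null_semicommutator fg)
  have R: "R n = ?T n (\<lambda>x. f x * g x) - ?\<Phi> n (?T n f) * ?\<Phi> n (?T n g)" for n
  proof -
    note c = toeplitz_carrier[of n f] toeplitz_carrier[of n g] pinching_carrier[of n "m n" "Q n"]
      toeplitz_carrier[of n "\<lambda>x. f x * g x"]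
    have "(?\<Phi> n (?T n f) - ?T n f) * ?T n g = ?\<Phi> n (?T n f) * ?T n g - ?T n f * ?T n g"
      by (rule minus_mult_distrib_mat[OF c(3,1,2)])
    moreover have "?\<Phi> n (?T n f) * (?\<Phi> n (?T n g) - ?T n g) = ?\<Phi> n (?T n f) * ?\<Phi> n (?T n g) - ?\<Phi> n (?T n f) * ?T n g"
      by (rule mult_minus_distrib_mat[OF c(3,3,2)])
    ultimately show ?thesis
      unfolding R_def semicommutator_def
      by (intro eq_matI) (simp_all add: carrier_matD[OF c(1)] carrier_matD[OF c(2)] carrier_matD[OF c(3)] carrier_matD[OF c(4)] del: index_mult_mat(1))
  qed
  have "?\<Phi> n (R n) - R n = ?\<Phi> n (?T n (\<lambda>x. f x * g x)) - ?T n (\<lambda>x. f x * g x)" for n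
  proof -
    note c = toeplitz_carrier[of n "\<lambda>x. f x * g x"] pinching_carrier[of n "m n" "Q n"]
    have "?\<Phi> n (R n) = ?\<Phi> n (?T n (\<lambda>x. f x * g x)) - ?\<Phi> n (?T n f) * ?\<Phi> n (?T n g)"
      unfolding R pinching_diff[OF Q c(1) mult_square[OF c(2) c(2)]]
        pinching_mult_pinching[OF Q toeplitz_carrier toeplitz_carrier] ..
    then show ?thesis
      unfolding R
      by (intro eq_matI) (simp_all add: carrier_matD[OF c(1)] carrier_matD[OF c(2)] del: index_mult_mat(1))
  qed
  moreover have "cluster_null (\<lambda>n. ?\<Phi> n (R n) - R n)"
    by (intro cluster_null_diff cluster_null_pinching Q R_null)
  moreover have "(\<lambda>x. f x * g x) \<in> cont_periodic"
    using fg by (auto simp: cont_periodic_def intro: continuous_on_mult)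
  ultimately show ?thesis by (simp add: pinching_compatible_def)
qed

text \<open>A uniformly small symbol has Toeplitz matrices of uniformly small operator norm, and pinching preserves
  this bound.\<close>

lemma pinching_compatible_limit:
  assumes Q: "\<And>n. projection_resolution n (m n) (Q n)"
    and F: "\<And>k. F k \<in> pinching_compatible m Q" and lim: "uniform_limit UNIV F f sequentially"
  shows "f \<in> pinching_compatible m Q"
proof -
  let ?\<Phi> = "\<lambda>n. pinching n (m n) (Q n)"
  have Fc: "F k \<in> cont_periodic" for k using F by (simp add: pinching_compatible_def)
  have f: "f \<in> cont_periodic" using cont_periodic_uniform_limit[OF _ lim] Fc by blast
  have "cluster_null (\<lambda>n. ?\<Phi> n (toeplitz n f) - toeplitz n f)"
  proof (rule cluster_null_limit)
    fix \<epsilon> :: real assume e: "\<epsilon> > 0"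
    have "\<forall>\<^sub>F k in sequentially. \<forall>x\<in>UNIV. dist (F k x) (f x) < \<epsilon> / 2"
      using lim e by (intro uniform_limitD) auto
    then obtain k where k: "\<And>x. dist (F k x) (f x) < \<epsilon> / 2"
      by (auto dest!: eventually_happens)
    let ?h = "\<lambda>x. f x - F k x"
    note c = cont_periodic_continuous_on[OF f, of "{0..2 * pi}"] cont_periodic_continuous_on[OF Fc[of k], of "{0..2 * pi}"]
    have h: "op_bound n (\<epsilon> / 2) (toeplitz n ?h)" for n
      by (rule op_bound_toeplitz)
        (use c k e in \<open>auto intro!: continuous_intros less_imp_le simp: dist_norm norm_minus_commute\<close>)
    have "op_bound n \<epsilon> (?\<Phi> n (toeplitz n f) - toeplitz n f - (?\<Phi> n (toeplitz n (F k)) - toeplitz n (F k)))" for n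
    proof -
      note tc = toeplitz_carrier[of n f] toeplitz_carrier[of n "F k"] pinching_carrier[of n "m n" "Q n"]
      have "?\<Phi> n (toeplitz n f) - toeplitz n f - (?\<Phi> n (toeplitz n (F k)) - toeplitz n (F k)) =
          ?\<Phi> n (toeplitz n ?h) - toeplitz n ?h"
        unfolding toeplitz_diff[OF c] pinching_diff[OF Q tc(1,2)]
        by (intro eq_matI) (simp_all add: carrier_matD[OF tc(1)] carrier_matD[OF tc(2)] carrier_matD[OF tc(3)])
      then show ?thesis using op_bound_diff[OF op_bound_pinching[OF Q h] h] by simp
    qed
    then show "\<exists>Y. cluster_null Y \<and> (\<forall>n. Y n \<in> carrier_mat n n \<and>
        op_bound n \<epsilon> (?\<Phi> n (toeplitz n f) - toeplitz n f - Y n))"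
      using F[of k] minus_carrier_mat[OF toeplitz_carrier]
      by (intro exI[of _ "\<lambda>n. ?\<Phi> n (toeplitz n (F k)) - toeplitz n (F k)"]) (simp add: pinching_compatible_def)
  qed (rule minus_carrier_mat[OF toeplitz_carrier])
  with f show ?thesis by (simp add: pinching_compatible_def)
qed

lemma cstar_subalgebra_pinching_compatible:
  assumes Q: "\<And>n. projection_resolution n (m n) (Q n)"
  shows "cstar_subalgebra (pinching_compatible m Q)"
  unfolding cstar_subalgebra_def
proof (intro conjI ballI allI impI)
  let ?\<Phi> = "\<lambda>n. pinching n (m n) (Q n)"
  let ?D = "\<lambda>f n. ?\<Phi> n (toeplitz n f) - toeplitz n f"
  note tc = toeplitz_carrier and pc = pinching_carrier
  note dims = carrier_matD[OF toeplitz_carrier] carrier_matD[OF pinching_carrier]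
  show "pinching_compatible m Q \<subseteq> cont_periodic" by (auto simp: pinching_compatible_def)
  have D_cmult: "?D (\<lambda>x. c * f x) n = c \<cdot>\<^sub>m ?D f n" for c f n
    unfolding toeplitz_cmult pinching_smult[OF Q tc]
    by (intro eq_matI) (simp_all add: dims right_diff_distrib)
  show "(\<lambda>x. c * f x) \<in> pinching_compatible m Q" if f: "f \<in> pinching_compatible m Q" for c f
  proof -
    have "cluster_null (\<lambda>n. c \<cdot>\<^sub>m ?D f n)"
      using f by (intro cluster_null_smult) (simp add: pinching_compatible_def)
    moreover have "(\<lambda>x. c * f x) \<in> cont_periodic"
      using f by (auto simp: pinching_compatible_def cont_periodic_def intro!: continuous_intros)
    ultimately show ?thesis by (simp add: pinching_compatible_def D_cmult)
  qed
  show "(\<lambda>x. 0) \<in> pinching_compatible m Q"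
  proof -
    have "frobenius_norm (?D (\<lambda>x. 0) n) = 0" for n
      using arg_cong[OF D_cmult[where c = 0 and f = "\<lambda>x. 0" and n = n], of frobenius_norm] by simp
    then have "cluster_null (?D (\<lambda>x. 0))"
      by (intro cluster_null_of_frobenius_bound[of _ 0] minus_carrier_mat[OF tc]) simp
    then show ?thesis by (simp add: pinching_compatible_def cont_periodic_def)
  qed
  show "(\<lambda>x. f x + h x) \<in> pinching_compatible m Q"
    if f: "f \<in> pinching_compatible m Q" and h: "h \<in> pinching_compatible m Q" for f h
  proof -
    have fh: "f \<in> cont_periodic" "h \<in> cont_periodic" using f h by (auto simp: pinching_compatible_def)
    have "?D (\<lambda>x. f x + h x) n = ?D f n + ?D h n" for n
      unfolding toeplitz_add[OF cont_periodic_continuous_on[OF fh(1)] cont_periodic_continuous_on[OF fh(2)]]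
        pinching_add[OF Q tc tc]
      by (intro eq_matI) (simp_all add: dims)
    moreover have "cluster_null (\<lambda>n. ?D f n + ?D h n)"
      using f h by (intro cluster_null_add) (simp_all add: pinching_compatible_def)
    moreover have "(\<lambda>x. f x + h x) \<in> cont_periodic"
      using fh by (auto simp: cont_periodic_def intro!: continuous_intros)
    ultimately show ?thesis by (simp add: pinching_compatible_def)
  qed
  show "(\<lambda>x. f x * h x) \<in> pinching_compatible m Q"
    if "f \<in> pinching_compatible m Q" and "h \<in> pinching_compatible m Q" for f h
    by (rule pinching_compatible_mult[OF Q that])
  show "(\<lambda>x. cnj (f x)) \<in> pinching_compatible m Q" if f: "f \<in> pinching_compatible m Q" for f
  proof -
    have "?D (\<lambda>x. cnj (f x)) n = mat_adjoint (?D f n)" for n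
      unfolding toeplitz_cnj mat_adjoint_diff[OF pc tc] pinching_adjoint[OF Q tc] ..
    moreover have "cluster_null (\<lambda>n. mat_adjoint (?D f n))"
      using f by (intro cluster_null_adjoint) (simp add: pinching_compatible_def)
    moreover have "(\<lambda>x. cnj (f x)) \<in> cont_periodic"
      using f by (auto simp: pinching_compatible_def cont_periodic_def intro!: continuous_intros)
    ultimately show ?thesis by (simp add: pinching_compatible_def)
  qed
  show "f \<in> pinching_compatible m Q"
    if "\<forall>k. F k \<in> pinching_compatible m Q" "uniform_limit UNIV F f sequentially"
    for F :: "nat \<Rightarrow> real \<Rightarrow> complex" and f
    by (rule pinching_compatible_limit[OF Q _ that(2)]) (use that(1) in blast)
qed

theorem theorem4p6:
  fixes m :: "nat \<Rightarrow> nat"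
    and P :: "nat \<Rightarrow> nat \<Rightarrow> complex mat"
    and U :: "nat \<Rightarrow> complex mat"
    and G :: "(real \<Rightarrow> complex) set"
  assumes "\<And>n. projection_resolution n (m n) (P n)"
    and "\<And>n. unitary_mat n (U n)"
    and "finite G"
    and "G \<subseteq> cont_periodic"
    and "\<And>g x. g \<in> G \<Longrightarrow> g x \<in> \<real>"
    and "\<And>f. f \<in> G \<union> (\<lambda>g x. (g x)\<^sup>2) ` G \<Longrightarrow>
           strong_cluster (\<lambda>n. frobenius_precond n (m n) (P n) (U n) (toeplitz n f))
             (\<lambda>n. toeplitz n f)"
  shows "\<forall>f \<in> generated_cstar G.
           strong_cluster (\<lambda>n. frobenius_precond n (m n) (P n) (U n) (toeplitz n f))
             (\<lambda>n. toeplitz n f)"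
proof
  define Q where "Q n k = U n * P n k * mat_adjoint (U n)" for n k
  have Q: "projection_resolution n (m n) (Q n)" for n
    using projection_resolution_conjugate[OF assms(1,2)] by (simp add: Q_def[abs_def])
  have precond: "frobenius_precond n (m n) (P n) (U n) (toeplitz n f) = pinching n (m n) (Q n) (toeplitz n f)" for n f
    using frobenius_precond_eq_pinching[OF assms(1,2) toeplitz_carrier] by (simp add: Q_def[abs_def])
  have "G \<subseteq> pinching_compatible m Q"
  proof
    fix g assume g: "g \<in> G"
    then have gc: "g \<in> cont_periodic" using assms(4) by blast
    have "strong_cluster (\<lambda>n. pinching n (m n) (Q n) (toeplitz n g)) (\<lambda>n. toeplitz n g)"
      using assms(6)[of g] g by (simp add: precond)
    moreover have "op_bounded (\<lambda>n. pinching n (m n) (Q n) (toeplitz n g) - toeplitz n g)"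
      using op_bounded_toeplitz[OF cont_periodic_continuous_on[OF gc]]
      by (intro op_bounded_diff op_bounded_pinching Q)
    ultimately show "g \<in> pinching_compatible m Q"
      using gc strong_clusterD by (simp add: pinching_compatible_def)
  qed
  then have sub: "generated_cstar G \<subseteq> pinching_compatible m Q"
    unfolding generated_cstar_def using cstar_subalgebra_pinching_compatible[OF Q]
    by (rule hull_minimal)
  fix f assume "f \<in> generated_cstar G"
  then show "strong_cluster (\<lambda>n. frobenius_precond n (m n) (P n) (U n) (toeplitz n f)) (\<lambda>n. toeplitz n f)"
    using sub unfolding precond by (intro strong_clusterI) (auto simp: pinching_compatible_def)
qed

end
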